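(* Let $\widetilde{G}$ be a connected $U(\mathbb{Q})$-gain graph of order $n$ with $c(\widetilde{G})\geq 1$ and $p(\widetilde{G})\geq 1$. Then $r(\widetilde{G})=n-2c(\widetilde{G})-p(\widetilde{G})+1$ if and only if $\widetilde{G}$ is obtained from a $U(\mathbb{Q})$-gain tree $\widetilde{T}$ with $p(\widetilde{T})>c(\widetilde{G})$ and $r(\widetilde{T})=|V(\widetilde{T})|-p(\widetilde{T})+1$ by attaching $c(\widetilde{G})$ $U(\mathbb{Q})$-gain cycles, each of Type 1, on $c(\widetilde{G})$ leaves of $\widetilde{T}$.
   Context: All graphs are finite and simple (no loops or multiple edges). $\mathbb{Q}$ denotes the real quaternions (not the rationals), and $U(\mathbb{Q})=\{q\in\mathbb{Q}:|q|=1\}$. A $U(\mathbb{Q})$-gain graph $\widetilde{G}=(G,U(\mathbb{Q}),\varphi)$ consists of a simple graph $G$ with vertices $v_1,\dots,v_n$ (the underlying graph) and a map $\varphi$ assigning to each ordered pair $(v_i,v_j)$ of adjacent vertices a unit quaternion $\varphi_{v_iv_j}$ with $\varphi_{v_iv_j}=\varphi_{v_jv_i}^{-1}=\overline{\varphi_{v_jv_i}}$. Its adjacency matrix $A(\widetilde{G})=(h_{ij})$ is the $n\times n$ Hermitian quaternion matrix with $h_{ij}=\varphi_{v_iv_j}$ if $v_i,v_j$ are adjacent and $h_{ij}=0$ otherwise. The rank $r(\widetilde{G})$ is the row left rank of $A(\widetilde{G})$, i.e. the maximum number of rows that are left linearly independent over $\mathbb{Q}$. $p(\widetilde{G})$ is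 the number of pendant vertices or leaves (vertices of degree 1), and $c(\widetilde{G})=|E(\widetilde{G})|-|V(\widetilde{G})|+\omega(\widetilde{G})$ is the cyclomatic number, where $\omega(\widetilde{G})$ is the number of connected components. A $U(\mathbb{Q})$-gain tree (cycle) is a $U(\mathbb{Q})$-gain graph whose underlying graph is a tree (cycle). A $U(\mathbb{Q})$-gain cycle with vertices $u_1,\dots,u_m$ in cyclic order ($m\ge 3$) is of Type 1 if $m$ is even and $\varphi_{u_1u_2}\varphi_{u_2u_3}\cdots\varphi_{u_{m-1}u_m}\varphi_{u_mu_1}=(-1)^{m/2}$ (this does not depend on the starting vertex or direction). Attaching a cycle on a leaf $x$ of a tree means identifying one vertex of the cycle (disjoint from everything else) with $x$, keeping all gains; the $c(\widetilde{G})$ cycles are attached on $c(\widetilde{G})$ distinct leaves, one cycle per leaf. *)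

theory Defs
  imports Complex_Main "Graph_Theory.Graph_Theory"
begin

section \<open>Real quaternions\<close>

datatype quat = Quat (qRe: real) (qI: real) (qJ: real) (qK: real)

instantiation quat :: division_ring
begin

definition "0 = Quat 0 0 0 0"
definition "1 = Quat 1 0 0 0"
definition "x + y = Quat (qRe x + qRe y) (qI x + qI y) (qJ x + qJ y) (qK x + qK y)"
definition "- x = Quat (- qRe x) (- qI x) (- qJ x) (- qK x)"
definition "x - y = Quat (qRe x - qRe y) (qI x - qI y) (qJ x - qJ y) (qK x - qK y)"

(* Hamilton's product: i^2 = j^2 = k^2 = -1, ij = k = -ji. *)
definition "x * y = Quat
   (qRe x * qRe y - qI x * qI y - qJ x * qJ y - qK x * qK y)
   (qRe x * qI y + qI x * qRe y + qJ x * qK y - qK x * qJ y)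
   (qRe x * qJ y - qI x * qK y + qJ x * qRe y + qK x * qI y)
   (qRe x * qK y + qI x * qJ y - qJ x * qI y + qK x * qRe y)"

definition "inverse x =
   (let s = (qRe x)\<^sup>2 + (qI x)\<^sup>2 + (qJ x)\<^sup>2 + (qK x)\<^sup>2
    in Quat (qRe x / s) (- qI x / s) (- qJ x / s) (- qK x / s))"

definition "x div y = x * inverse (y :: quat)"

lemmas quat_defs = zero_quat_def one_quat_def plus_quat_def uminus_quat_def minus_quat_def
  times_quat_def

lemma quat_sumsq_nonzero:
  assumes "x \<noteq> (0 :: quat)"
  shows "(qRe x)\<^sup>2 + (qI x)\<^sup>2 + (qJ x)\<^sup>2 + (qK x)\<^sup>2 \<noteq> 0"
proof
  assume h: "(qRe x)\<^sup>2 + (qI x)\<^sup>2 + (qJ x)\<^sup>2 + (qK x)\<^sup>2 = 0"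
  have "0 \<le> (qRe x)\<^sup>2" "0 \<le> (qI x)\<^sup>2" "0 \<le> (qJ x)\<^sup>2" "0 \<le> (qK x)\<^sup>2"
    by simp_all
  with h have "(qRe x)\<^sup>2 = 0" "(qI x)\<^sup>2 = 0" "(qJ x)\<^sup>2 = 0" "(qK x)\<^sup>2 = 0"
    by linarith+
  then have "x = 0" by (cases x) (simp add: zero_quat_def)
  with assms show False by simp
qed

instance
proof
  fix a b c :: quat
  show "a + b + c = a + (b + c)" "a + b = b + a" "0 + a = a" "- a + a = 0" "a - b = a + - b"
    by (simp_all add: quat_defs)
  show "a * b * c = a * (b * c)" "(a + b) * c = a * c + b * c" "a * (b + c) = a * b + a * c"
    by (simp_all add: quat_defs algebra_simps)
  show "1 * a = a" "a * 1 = a" "(0 :: quat) \<noteq> 1"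
    by (simp_all add: quat_defs)
  show "a div b = a * inverse b" by (simp add: divide_quat_def)
  show "inverse (0 :: quat) = 0" by (simp add: inverse_quat_def zero_quat_def)
  assume "a \<noteq> 0"
  then have nz: "(qRe a)\<^sup>2 + (qI a)\<^sup>2 + (qJ a)\<^sup>2 + (qK a)\<^sup>2 \<noteq> 0" by (rule quat_sumsq_nonzero)
  show "inverse a * a = 1" "a * inverse a = 1"
    using nz
    by (simp_all add: inverse_quat_def times_quat_def one_quat_def Let_def
        add_divide_distrib[symmetric] diff_divide_distrib[symmetric] power2_eq_square
        algebra_simps)
qed

end

definition qnorm :: "quat \<Rightarrow> real" where
  "qnorm q = sqrt ((qRe q)\<^sup>2 + (qI q)\<^sup>2 + (qJ q)\<^sup>2 + (qK q)\<^sup>2)"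

definition qcnj :: "quat \<Rightarrow> quat" where
  "qcnj q = Quat (qRe q) (- qI q) (- qJ q) (- qK q)"


section \<open>Row left rank\<close>

text \<open>A matrix is a function of a row and a column index. Independence is that of the family of
  rows indexed by \<open>S\<close>, with coefficients acting from the left.\<close>

definition left_independent_rows ::
  "('i \<Rightarrow> 'j \<Rightarrow> 'k::division_ring) \<Rightarrow> 'j set \<Rightarrow> 'i set \<Rightarrow> bool" where
  "left_independent_rows A J S \<longleftrightarrow>
     (\<forall>c. (\<forall>j\<in>J. (\<Sum>i\<in>S. c i * A i j) = 0) \<longrightarrow> (\<forall>i\<in>S. c i = 0))"

definition row_left_rank :: "('i \<Rightarrow> 'j \<Rightarrow> 'k::division_ring) \<Rightarrow> 'i set \<Rightarrow> 'j set \<Rightarrow> nat" where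
  "row_left_rank A I J = Max {card S | S. S \<subseteq> I \<and> left_independent_rows A J S}"


section \<open>Simple graphs\<close>

text \<open>A finite simple graph is a \<^locale>\<open>pair_graph\<close>, a finite loop-free symmetric digraph, in which
  an undirected edge consists of the two arcs \<open>(u,v)\<close> and \<open>(v,u)\<close>.\<close>

definition edges :: "'a pair_pre_digraph \<Rightarrow> 'a set set" where
  "edges G = (\<lambda>(u, v). {u, v}) ` parcs G"

definition pendants :: "'a pair_pre_digraph \<Rightarrow> 'a set" where
  "pendants G = {v \<in> pverts G. out_degree (with_proj G) v = 1}"

text \<open>For symmetric digraphs the strongly connected components are the connected components.\<close>

definition cyclomatic :: "'a pair_pre_digraph \<Rightarrow> int" where
  "cyclomatic G = int (card (edges G)) - int (card (pverts G))
     + int (card (pre_digraph.sccs (with_proj G)))"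

definition cycle_order :: "'a pair_pre_digraph \<Rightarrow> 'a list \<Rightarrow> bool" where
  "cycle_order C us \<longleftrightarrow> length us \<ge> 3 \<and> distinct us \<and> pverts C = set us \<and>
     parcs C = (\<Union>i<length us. {(us ! i, us ! (Suc i mod length us)),
                                (us ! (Suc i mod length us), us ! i)})"

text \<open>The library's \<^const>\<open>Digraph_Component.tree\<close> is not suitable here: its cycles are directed
  ones, so it counts \<open>u, v, u\<close> as a cycle and excludes every symmetric digraph with an edge.\<close>

definition tree_graph :: "'a pair_pre_digraph \<Rightarrow> bool" where
  "tree_graph T \<longleftrightarrow> pair_graph T \<and> Digraph_Component.connected (with_proj T) \<and>
     \<not> (\<exists>C us. cycle_order C us \<and> subgraph (with_proj C) (with_proj T))"


section \<open>Gain graphs over the unit quaternions\<close>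

record 'a gain_graph =
  ugraph :: "'a pair_pre_digraph"
  gain :: "'a \<Rightarrow> 'a \<Rightarrow> quat"

text \<open>The values of \<^const>\<open>gain\<close> at non-adjacent pairs carry no information.\<close>

definition uq_gain_graph :: "'a gain_graph \<Rightarrow> bool" where
  "uq_gain_graph G \<longleftrightarrow> pair_graph (ugraph G) \<and>
     (\<forall>(u, v) \<in> parcs (ugraph G). qnorm (gain G u v) = 1 \<and>
        gain G u v = inverse (gain G v u) \<and> gain G u v = qcnj (gain G v u))"

definition adjacency :: "'a gain_graph \<Rightarrow> 'a \<Rightarrow> 'a \<Rightarrow> quat" where
  "adjacency G u v = (if (u, v) \<in> parcs (ugraph G) then gain G u v else 0)"

abbreviation gverts :: "'a gain_graph \<Rightarrow> 'a set" where
  "gverts G \<equiv> pverts (ugraph G)"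

abbreviation garcs :: "'a gain_graph \<Rightarrow> ('a \<times> 'a) set" where
  "garcs G \<equiv> parcs (ugraph G)"

definition gorder :: "'a gain_graph \<Rightarrow> nat" where
  "gorder G = card (gverts G)"

definition grank :: "'a gain_graph \<Rightarrow> nat" where
  "grank G = row_left_rank (adjacency G) (gverts G) (gverts G)"

definition gpendant :: "'a gain_graph \<Rightarrow> nat" where
  "gpendant G = card (pendants (ugraph G))"

definition gcyclomatic :: "'a gain_graph \<Rightarrow> int" where
  "gcyclomatic G = cyclomatic (ugraph G)"

definition gconnected :: "'a gain_graph \<Rightarrow> bool" where
  "gconnected G \<longleftrightarrow> Digraph_Component.connected (with_proj (ugraph G))"

definition gain_tree :: "'a gain_graph \<Rightarrow> bool" where
  "gain_tree T \<longleftrightarrow> uq_gain_graph T \<and> tree_graph (ugraph T)"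

definition cycle_gain :: "'a gain_graph \<Rightarrow> 'a list \<Rightarrow> quat" where
  "cycle_gain C us =
     prod_list (map (\<lambda>i. gain C (us ! i) (us ! (Suc i mod length us))) [0..<length us])"

definition type1_cycle :: "'a gain_graph \<Rightarrow> bool" where
  "type1_cycle C \<longleftrightarrow> uq_gain_graph C \<and>
     (\<exists>us. cycle_order (ugraph C) us \<and> even (length us) \<and>
        cycle_gain C us = (- 1) ^ (length us div 2))"

text \<open>\<open>G\<close> arises from \<open>T\<close> by attaching, for every \<open>x \<in> L\<close>, the cycle \<open>C x\<close> on the leaf \<open>x\<close>.
  The pieces are named as they sit in \<open>G\<close> after the identification, so that the vertex of \<open>C x\<close>
  identified with \<open>x\<close> is called \<open>x\<close>, and is the only vertex \<open>C x\<close> shares with any other piece.\<close>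

definition attached_cycles ::
  "'a gain_graph \<Rightarrow> 'a gain_graph \<Rightarrow> 'a set \<Rightarrow> ('a \<Rightarrow> 'a gain_graph) \<Rightarrow> bool" where
  "attached_cycles G T L C \<longleftrightarrow>
     L \<subseteq> pendants (ugraph T) \<and>
     (\<forall>x\<in>L. gverts (C x) \<inter> gverts T = {x}) \<and>
     (\<forall>x\<in>L. \<forall>y\<in>L. x \<noteq> y \<longrightarrow> gverts (C x) \<inter> gverts (C y) = {}) \<and>
     gverts G = gverts T \<union> (\<Union>x\<in>L. gverts (C x)) \<and>
     garcs G = garcs T \<union> (\<Union>x\<in>L. garcs (C x)) \<and>
     (\<forall>(u, v) \<in> garcs T. gain G u v = gain T u v) \<and>
     (\<forall>x\<in>L. \<forall>(u, v) \<in> garcs (C x). gain G u v = gain (C x) u v)"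

end

theory Submission
  imports Defs
begin

text \<open>
  Let \<open>A\<close> be the adjacency matrix. A vector of the left kernel that vanishes on all neighbours of
  \<open>v\<close> but one vanishes on that one as well. Start at a pendant vertex and process the vertices along
  a connected search: setting one coordinate to zero at the start, and then at most \<open>deg v - 2\<close>
  coordinates at each vertex \<open>v\<close>, forces every coordinate to be zero. Hence the nullity is at most
  \<open>1 + (\<Sum>v. max 0 (deg v - 2))\<close>, which is \<open>2c + p - 1\<close> for a connected graph. The theorem
  characterises equality in this bound.

  If equality holds and there is a cycle, then reaching the cycle from the pendant vertex and varying
  the order in which its vertices are processed would save a coordinate unless the cycle has exactly
  one vertex of degree above 2, this vertex has degree 3, and the cycle is of Type 1. Such a cycle
  contributes exactly 1 to the nullity and exactly 1 to the bound, so it can be replaced by a leaf,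
  and induction leaves a tree. Conversely, attaching a cycle of Type 1 at any vertex raises the
  nullity by exactly 1.
\<close>

section \<open>Row rank and left nullity\<close>

text \<open>The kernel is never formed as a space. The rank is given by independent sets of rows, so
  \<open>left_nullity A S I\<close> measures the freedom of kernel vectors supported in
  \<open>I\<close>, and setting a coordinate to zero means deleting its index from \<open>I\<close>.

  A saving occurs when a vertex is processed with two neighbours already zero, because the cost deg
  - 2 takes only one of them into account. Any vertex of a cycle can be brought into this position
  by processing the rest of the cycle before it, except the vertex through which the search enters
  the cycle. This makes all the other vertices have degree 2. For the entry, the search is halted in
  front of the cycle, and the freedom left there is read off from kernel vectors that vanish at the
  entry. After division by path gains such a vector alternates in sign along every second vertex. It
  returns to the entry consistently only if the length m is even, and the equation at the entry then
  singles out the cycle gain (-1)^(m/2); this is the origin of Type 1.\<close>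

lemma finite_independent_cards:
  "finite I \<Longrightarrow> finite {card S | S. S \<subseteq> I \<and> left_independent_rows A J S}"
  by (rule finite_subset[of _ "card ` Pow I"]) auto

lemma card_le_row_left_rank:
  assumes "finite I" "S \<subseteq> I" "left_independent_rows A J S"
  shows "card S \<le> row_left_rank A I J"
  unfolding row_left_rank_def
  using assms by (intro Max_ge finite_independent_cards) auto

lemma row_left_rank_attained:
  assumes "finite I"
  obtains S where "S \<subseteq> I" "left_independent_rows A J S" "card S = row_left_rank A I J"
proof -
  have "left_independent_rows A J {}" by (simp add: left_independent_rows_def)
  then have "{card S | S. S \<subseteq> I \<and> left_independent_rows A J S} \<noteq> {}" by blast
  then have "row_left_rank A I J \<in> {card S | S. S \<subseteq> I \<and> left_independent_rows A J S}"
    unfolding row_left_rank_def by (rule Max_in[OF finite_independent_cards[OF assms]])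
  then show ?thesis using that by auto
qed

lemma row_left_rank_le_card: "finite I \<Longrightarrow> row_left_rank A I J \<le> card I"
  by (rule row_left_rank_attained[of I A J]) (auto dest: card_mono)

text \<open>Coefficients on \<open>S\<close> are extended by zero to the fixed set \<open>I\<close>.
  Independence becomes a statement about kernel vectors on \<open>I\<close> with prescribed zeros,
  so row sets of different sizes are compared through one and the same equation.\<close>

lemma left_independent_rows_iff:
  assumes "finite I" "S \<subseteq> I"
  shows "left_independent_rows A J S \<longleftrightarrow>
    (\<forall>x. (\<forall>i\<in>I - S. x i = 0) \<longrightarrow> (\<forall>j\<in>J. (\<Sum>i\<in>I. x i * A i j) = 0) \<longrightarrow> (\<forall>i\<in>S. x i = 0))"
    (is "_ \<longleftrightarrow> ?R")
proof
  assume S: "left_independent_rows A J S"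
  show ?R
  proof (intro allI impI)
    fix x assume x: "\<forall>i\<in>I - S. x i = 0" and k: "\<forall>j\<in>J. (\<Sum>i\<in>I. x i * A i j) = 0"
    have "(\<Sum>i\<in>S. x i * A i j) = (\<Sum>i\<in>I. x i * A i j)" for j
      using assms x by (intro sum.mono_neutral_left) auto
    with k S show "\<forall>i\<in>S. x i = 0" unfolding left_independent_rows_def by simp
  qed
next
  assume R: ?R
  show "left_independent_rows A J S" unfolding left_independent_rows_def
  proof (intro allI impI)
    fix c assume k: "\<forall>j\<in>J. (\<Sum>i\<in>S. c i * A i j) = 0"
    define x where "x i = (if i \<in> S then c i else 0)" for i
    have "(\<Sum>i\<in>S. c i * A i j) = (\<Sum>i\<in>I. x i * A i j)" for j
      using assms by (intro sum.mono_neutral_cong_left) (auto simp: x_def)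
    with k R[rule_format, of x] show "\<forall>i\<in>S. c i = 0" by (simp add: x_def)
  qed
qed

lemma left_independent_rowsD:
  assumes "left_independent_rows A J S" "finite I" "S \<subseteq> I" "\<And>i. i \<in> I - S \<Longrightarrow> x i = 0"
    "\<And>j. j \<in> J \<Longrightarrow> (\<Sum>i\<in>I. x i * A i j) = 0" "i \<in> S"
  shows "x i = 0"
  using assms left_independent_rows_iff[of I S A J] by blast

lemma left_independent_rowsI:
  assumes "finite I" "S \<subseteq> I"
    "\<And>x i. \<lbrakk>\<And>i. i \<in> I - S \<Longrightarrow> x i = 0; \<And>j. j \<in> J \<Longrightarrow> (\<Sum>i\<in>I. x i * A i j) = 0; i \<in> S\<rbrakk> \<Longrightarrow> x i = 0"
  shows "left_independent_rows A J S"
  using assms left_independent_rows_iff[of I S A J] by blast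

lemma row_left_rank_mono:
  assumes "finite I" "I' \<subseteq> I"
  shows "row_left_rank A I' J \<le> row_left_rank A I J"
proof -
  obtain S where S: "S \<subseteq> I'" "left_independent_rows A J S" "card S = row_left_rank A I' J"
    using row_left_rank_attained[of I'] assms finite_subset by blast
  then show ?thesis using card_le_row_left_rank[of I S A J] assms by auto
qed

lemma row_left_rank_cong:
  assumes "\<And>i j. i \<in> I \<Longrightarrow> j \<in> J \<Longrightarrow> A i j = B i j"
  shows "row_left_rank A I J = row_left_rank B I J"
proof -
  have "left_independent_rows A J S \<longleftrightarrow> left_independent_rows B J S" if "S \<subseteq> I" for S
  proof -
    have "(\<Sum>i\<in>S. c i * A i j) = (\<Sum>i\<in>S. c i * B i j)" if "j \<in> J" for j c
      using \<open>S \<subseteq> I\<close> that assms by (intro sum.cong) auto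
    then show ?thesis unfolding left_independent_rows_def by simp
  qed
  then have "{card S | S. S \<subseteq> I \<and> left_independent_rows A J S}
      = {card S | S. S \<subseteq> I \<and> left_independent_rows B J S}" by blast
  then show ?thesis unfolding row_left_rank_def by (rule arg_cong)
qed

text \<open>For finite \<open>I\<close> this is the dimension of the space of vectors supported in
  \<open>I\<close> whose row combination vanishes in every column of \<open>J\<close>. During the
  search \<open>I\<close> shrinks while \<open>J\<close> stays the full vertex set.\<close>

definition left_nullity :: "('i \<Rightarrow> 'j \<Rightarrow> 'k::division_ring) \<Rightarrow> 'j set \<Rightarrow> 'i set \<Rightarrow> nat" where
  "left_nullity A J I = card I - row_left_rank A I J"

lemma row_left_rank_plus_left_nullity:
  "finite I \<Longrightarrow> row_left_rank A I J + left_nullity A J I = card I"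
  by (simp add: left_nullity_def row_left_rank_le_card)

lemma left_nullity_empty [simp]: "left_nullity A J {} = 0"
  by (simp add: left_nullity_def)

text \<open>Deleting rows cannot raise the rank, so each coordinate set to zero costs at most
  1.\<close>

lemma left_nullity_Diff:
  assumes "finite I"
  shows "left_nullity A J I \<le> left_nullity A J (I - W) + card (I \<inter> W)"
proof -
  have "row_left_rank A (I - W) J \<le> row_left_rank A I J"
    using assms by (intro row_left_rank_mono) auto
  moreover have "card I = card (I - W) + card (I \<inter> W)"
    using card_Diff_subset_Int[of I W] card_mono[of I "I \<inter> W"] assms by simp
  ultimately show ?thesis
    using row_left_rank_plus_left_nullity[of I A J] row_left_rank_plus_left_nullity[of "I - W" A J] assms
    by auto
qed

text \<open>If no kernel vector supported in \<open>I\<close> involves \<open>w\<close>, then row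
  \<open>w\<close> extends every independent set of other rows of \<open>I\<close>; the rank grows
  along with the number of rows, and deleting \<open>w\<close> is free. The contrapositive later
  produces a kernel vector with a nonzero entry at \<open>w\<close>.\<close>

lemma left_nullity_forced:
  assumes "finite I"
    and forced: "\<And>x. (\<And>i. i \<notin> I \<Longrightarrow> x i = 0) \<Longrightarrow>
      (\<And>j. j \<in> J \<Longrightarrow> (\<Sum>i\<in>I. x i * A i j) = 0) \<Longrightarrow> x w = 0"
  shows "left_nullity A J I \<le> left_nullity A J (I - {w})"
proof (cases "w \<in> I")
  case True
  obtain S where S: "S \<subseteq> I - {w}" "left_independent_rows A J S" "card S = row_left_rank A (I - {w}) J"
    using row_left_rank_attained[of "I - {w}"] assms(1) by blast
  have "left_independent_rows A J (insert w S)"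
  proof (rule left_independent_rowsI[OF assms(1)])
    fix x i
    assume x: "\<And>i. i \<in> I - insert w S \<Longrightarrow> x i = 0"
      and k: "\<And>j. j \<in> J \<Longrightarrow> (\<Sum>i\<in>I. x i * A i j) = 0" and i: "i \<in> insert w S"
    \<comment> \<open>\<open>x\<close> is unrestricted outside \<open>I\<close>, whereas
      \<open>forced\<close> speaks of vectors supported in \<open>I\<close>; the truncated vector
      has the same sums over \<open>I\<close>.\<close>
    have "(if w \<in> I then x w else 0) = 0"
      using k by (intro forced[of "\<lambda>i. if i \<in> I then x i else 0"]) (auto cong: sum.cong)
    then have w: "x w = 0" using True by simp
    show "x i = 0"
    proof (cases "i = w")
      case False
      show ?thesis
        by (rule left_independent_rowsD[OF S(2) assms(1)]) (use S(1) x k w i False in auto)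
    qed (use w in simp)
  qed (use S True in auto)
  then have "card (insert w S) \<le> row_left_rank A I J"
    using S True by (intro card_le_row_left_rank assms) auto
  moreover have "card (insert w S) = Suc (row_left_rank A (I - {w}) J)"
    using S assms(1) finite_subset[of S I] by (subst card_insert_disjoint) auto
  moreover have "Suc (card (I - {w})) = card I" using True assms(1) by (metis card.remove)
  ultimately show ?thesis by (simp add: left_nullity_def)
qed simp

section \<open>Zero forcing from a leaf\<close>

text \<open>Two indices are adjacent iff their entry is nonzero; as \<open>inverse 0 = 0\<close>, the first assumption
  also covers pairs that are not adjacent.\<close>

locale gain_matrix =
  fixes A :: "'a \<Rightarrow> 'a \<Rightarrow> 'k::division_ring"
  assumes inv: "A j i = inverse (A i j)"
    and diag: "A i i = 0"
begin

lemma adj_sym: "A i j \<noteq> 0 \<longleftrightarrow> A j i \<noteq> 0"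
  using inv[of j i] by simp

definition nbrs :: "'a set \<Rightarrow> 'a \<Rightarrow> 'a set" where
  "nbrs S v = {u \<in> S. A v u \<noteq> 0}"

abbreviation deg :: "'a set \<Rightarrow> 'a \<Rightarrow> nat" where
  "deg S v \<equiv> card (nbrs S v)"

definition nbhd :: "'a set \<Rightarrow> 'a set \<Rightarrow> 'a set" where
  "nbhd S W = (\<Union>u\<in>W. nbrs S u)"

text \<open>Connectivity of \<open>W\<close> from \<open>P\<close> in cut form: the arc leaving an
  intermediate set supplies the next vertex of the search, so no paths have to be
  constructed.\<close>

definition reaches :: "'a set \<Rightarrow> 'a set \<Rightarrow> bool" where
  "reaches P W \<longleftrightarrow> P \<subseteq> W \<and> (\<forall>Q. P \<subseteq> Q \<longrightarrow> Q \<subset> W \<longrightarrow> (\<exists>u\<in>Q. \<exists>v\<in>W - Q. A u v \<noteq> 0))"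

definition linked :: "'a set \<Rightarrow> bool" where
  "linked S \<longleftrightarrow> S \<noteq> {} \<and> (\<forall>Q. Q \<noteq> {} \<longrightarrow> Q \<subset> S \<longrightarrow> (\<exists>u\<in>Q. \<exists>v\<in>S - Q. A u v \<noteq> 0))"

text \<open>The truncated subtraction is intended: a leaf contributes 0.\<close>

definition bnd :: "'a set \<Rightarrow> nat" where
  "bnd S = 1 + (\<Sum>v\<in>S. deg S v - 2)"

lemma reaches_insert: "reaches P W \<Longrightarrow> v \<in> W \<Longrightarrow> reaches (insert v P) W"
  by (auto simp: reaches_def)

lemma linked_reaches: "linked S \<Longrightarrow> P \<noteq> {} \<Longrightarrow> P \<subseteq> S \<Longrightarrow> reaches P S"
  unfolding linked_def reaches_def by (metis bot.extremum_uniqueI)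

lemma finite_nbrs [simp]: "finite S \<Longrightarrow> finite (nbrs S v)"
  by (simp add: nbrs_def)

text \<open>The column of \<open>v\<close> involves only neighbours of \<open>v\<close>. All of
  those still in \<open>I\<close> except one are set to zero at a cost of 1 each, and the column
  equation then kills the last one for free. The truncated \<open>- 1\<close> covers the case that
  no neighbour is left in \<open>I\<close>.\<close>

lemma force_step:
  assumes "finite S" "I \<subseteq> S" "v \<in> S"
  shows "left_nullity A S I \<le> left_nullity A S (I - nbrs S v) + (card (nbrs S v \<inter> I) - 1)"
proof (cases "nbrs S v \<inter> I = {}")
  case True
  then have "I - nbrs S v = I" by blast
  then show ?thesis by simp
next
  case False
  then obtain w where w: "w \<in> nbrs S v" "w \<in> I" by blast
  have fin: "finite I" using assms finite_subset by blast
  define W where "W = nbrs S v \<inter> I - {w}"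
  have "I \<inter> W = nbrs S v \<inter> I - {w}" by (auto simp: W_def)
  then have "card (I \<inter> W) = card (nbrs S v \<inter> I) - 1"
    using w by simp
  with left_nullity_Diff[OF fin, of A S W]
  have 1: "left_nullity A S I \<le> left_nullity A S (I - W) + (card (nbrs S v \<inter> I) - 1)" by simp
  have 2: "left_nullity A S (I - W) \<le> left_nullity A S (I - W - {w})"
  proof (rule left_nullity_forced)
    fix x assume k: "\<And>j. j \<in> S \<Longrightarrow> (\<Sum>i\<in>I - W. x i * A i j) = 0"
    have "(\<Sum>i\<in>I - W. x i * A i v) = (\<Sum>i\<in>{w}. x i * A i v)"
    proof (rule sum.mono_neutral_right)
      show "\<forall>i\<in>I - W - {w}. x i * A i v = 0"
        using assms(2) adj_sym[of v] by (auto simp: W_def nbrs_def)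
    qed (use fin w in \<open>auto simp: W_def\<close>)
    then have "x w * A w v = 0" using k[OF assms(3)] by simp
    moreover have "A w v \<noteq> 0" using w adj_sym[of v w] by (auto simp: nbrs_def)
    ultimately show "x w = 0" by simp
  qed (use fin in simp)
  have "I - W - {w} = I - nbrs S v" using w by (auto simp: W_def)
  with 1 2 show ?thesis by simp
qed

text \<open>The invariant is that the processed set \<open>P\<close> and all its neighbours are
  already zero. The next vertex \<open>v\<close> has a neighbour in \<open>P\<close>, so at most deg
  - 1 of its neighbours are still free, and \<open>force_step\<close> charges at most deg - 2. Being
  a neighbour of \<open>P\<close>, \<open>v\<close> itself is already zero, so the invariant
  persists.\<close>

lemma spread:
  assumes "finite S" "W \<subseteq> S" "I \<subseteq> S" "reaches P W" "I \<inter> P = {}" "I \<inter> nbhd S P = {}"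
  shows "left_nullity A S I \<le> left_nullity A S (I - W - nbhd S W) + (\<Sum>v\<in>W - P. deg S v - 2)"
  using assms(3-)
proof (induction "card (W - P)" arbitrary: P I)
  case 0
  have fin: "finite W" using assms finite_subset by blast
  have "W = P" using 0 fin by (auto simp: reaches_def)
  with 0 have "I - W - nbhd S W = I" by blast
  then show ?case by simp
next
  case (Suc n)
  have fin: "finite W" using assms finite_subset by blast
  have "P \<subset> W" using Suc(2) Suc.prems(2) unfolding reaches_def by force
  then obtain u v where uv: "u \<in> P" "v \<in> W - P" "A u v \<noteq> 0"
    using Suc.prems(2) unfolding reaches_def by blast
  define U where "U = nbrs S v \<inter> I"
  have vS: "v \<in> S" using uv assms(2) by blast
  have vI: "v \<notin> I" using uv vS Suc.prems(4) by (auto simp: nbhd_def nbrs_def)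
  have sum: "(\<Sum>v\<in>W - P. deg S v - 2) = (deg S v - 2) + (\<Sum>v\<in>W - insert v P. deg S v - 2)"
    using sum.remove[of "W - P" v "\<lambda>v. deg S v - 2"] fin uv by (simp add: Diff_insert[of W v P])
  have "u \<in> nbrs S v - U"
    using uv Suc.prems(2,3) assms(2) adj_sym[of v u] by (auto simp: U_def nbrs_def reaches_def)
  then have "U \<subset> nbrs S v" by (auto simp: U_def)
  then have "card U < deg S v" using assms(1) by (intro psubset_card_mono) auto
  moreover have "left_nullity A S I \<le> left_nullity A S (I - nbrs S v) + (card U - 1)"
    unfolding U_def by (rule force_step[OF assms(1) Suc.prems(1) vS])
  moreover have "left_nullity A S (I - nbrs S v) \<le> left_nullity A S (I - nbrs S v - W - nbhd S W)
      + (\<Sum>v\<in>W - insert v P. deg S v - 2)"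
  proof (rule Suc(1))
    show "n = card (W - insert v P)"
      using Suc(2) uv by (simp add: Diff_insert[of W v P])
    show "reaches (insert v P) W" using Suc.prems(2) uv by (auto intro: reaches_insert)
    show "(I - nbrs S v) \<inter> nbhd S (insert v P) = {}"
      using Suc.prems(4) by (auto simp: nbhd_def)
  qed (use Suc.prems vI in auto)
  moreover have "I - nbrs S v - W - nbhd S W = I - W - nbhd S W"
    using uv by (auto simp: nbhd_def)
  ultimately show ?case using sum by simp
qed

lemma forcing_bound:
  assumes "finite S" "I \<subseteq> S" "reaches P S" "I \<inter> P = {}" "I \<inter> nbhd S P = {}"
  shows "left_nullity A S I \<le> (\<Sum>v\<in>S - P. deg S v - 2)"
proof -
  have "I - S = {}" using assms(2) by blast
  with spread[of S S I P] assms show ?thesis by simp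
qed

text \<open>The summand 1 pays for the coordinate of \<open>l\<close>. The only neighbour of
  \<open>l\<close> is then forced to zero for free, which establishes the invariant of the search;
  the share of \<open>l\<close> itself is 0 by truncation.\<close>

lemma leaf_start:
  assumes "finite S" "W \<subseteq> S" "l \<in> S" "deg S l = 1" "reaches {l} W"
  shows "left_nullity A S S
    \<le> 1 + (\<Sum>v\<in>W. deg S v - 2) + left_nullity A S (S - W - nbhd S W)"
proof -
  define I where "I = S - {l}"
  have l: "l \<in> W" using assms(5) by (auto simp: reaches_def)
  have "left_nullity A S S \<le> left_nullity A S I + card (S \<inter> {l})"
    unfolding I_def by (rule left_nullity_Diff[OF assms(1)])
  moreover have "card (nbrs S l \<inter> I) \<le> deg S l" using assms(1) by (intro card_mono) auto
  then have "left_nullity A S I \<le> left_nullity A S (I - nbrs S l)"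
    using force_step[of S I l] assms by (auto simp: I_def)
  moreover have "left_nullity A S (I - nbrs S l)
      \<le> left_nullity A S (I - nbrs S l - W - nbhd S W) + (\<Sum>v\<in>W - {l}. deg S v - 2)"
    by (rule spread) (use assms in \<open>auto simp: I_def nbhd_def\<close>)
  moreover have "I - nbrs S l - W - nbhd S W = S - W - nbhd S W"
    using l by (auto simp: I_def nbhd_def)
  moreover have "(\<Sum>v\<in>W - {l}. deg S v - 2) = (\<Sum>v\<in>W. deg S v - 2)"
    using assms finite_subset[of W S] l by (intro sum.mono_neutral_left) auto
  moreover have "card (S \<inter> {l}) = 1" using assms by simp
  ultimately show ?thesis by simp
qed

text \<open>Every vertex other than \<open>r\<close> costs at most its share \<open>deg - 2\<close> of the bound, so the bound can
  only be met if forcing the neighbours of \<open>r\<close> is not cheaper than \<open>deg r - 2\<close>.\<close>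

lemma leaf_forcing:
  assumes "finite S" "linked S" "W \<subseteq> S" "l \<in> S" "deg S l = 1" "reaches {l} W"
    and r: "r \<in> S - W" "w \<in> W" "A w r \<noteq> 0"
    and I: "I \<subseteq> S - W - nbhd S W"
    and t: "left_nullity A S (S - W - nbhd S W) \<le> t + left_nullity A S I"
  shows "left_nullity A S S + (deg S r - 2) \<le> bnd S + t + (card (nbrs S r \<inter> I) - 1)"
proof -
  have fin: "finite W" using assms finite_subset by blast
  have rI: "r \<notin> I" using r I by (auto simp: nbhd_def nbrs_def)
  \<comment> \<open>\<open>t\<close> is the price of shrinking the remaining support to
    \<open>I\<close> before \<open>r\<close> is processed. A contradiction to equality arises
    whenever \<open>t\<close> together with the cost of \<open>r\<close> computed from
    \<open>I\<close> stays below deg r - 2.\<close>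
  have "left_nullity A S I \<le> left_nullity A S (I - nbrs S r) + (card (nbrs S r \<inter> I) - 1)"
    using force_step[of S I r] assms by blast
  moreover have "left_nullity A S (I - nbrs S r) \<le> (\<Sum>v\<in>S - insert r W. deg S v - 2)"
  proof (rule forcing_bound)
    show "reaches (insert r W) S" by (rule linked_reaches) (use assms in auto)
  qed (use assms rI in \<open>auto simp: nbhd_def\<close>)
  moreover have "left_nullity A S S
      \<le> 1 + (\<Sum>v\<in>W. deg S v - 2) + left_nullity A S (S - W - nbhd S W)"
    using assms by (intro leaf_start) auto
  moreover have "bnd S = 1 + (\<Sum>v\<in>W. deg S v - 2) + (deg S r - 2) + (\<Sum>v\<in>S - insert r W. deg S v - 2)"
  proof -
    have "(\<Sum>v\<in>S. deg S v - 2)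
        = (\<Sum>v\<in>S - insert r W. deg S v - 2) + (\<Sum>v\<in>insert r W. deg S v - 2)"
      using assms by (intro sum.subset_diff) auto
    then show ?thesis using fin r by (simp add: bnd_def)
  qed
  ultimately show ?thesis using t by simp
qed

end

section \<open>Cycles\<close>

lemma card_Diff_Int_le:
  assumes "finite N" "D \<subseteq> N" "D \<inter> I = {}"
  shows "card (N \<inter> I) + card D \<le> card N"
proof -
  have "card (N \<inter> I) + card D = card (N \<inter> I \<union> D)"
    using assms finite_subset[of D N] by (intro card_Un_disjoint[symmetric]) auto
  also have "\<dots> \<le> card N" using assms by (intro card_mono) auto
  finally show ?thesis .
qed

lemma nat_crossing:
  fixes a b :: nat
  assumes "P a" "\<not> P b" "a < b"
  obtains i where "a \<le> i" "i < b" "P i" "\<not> P (Suc i)"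
proof -
  have "\<exists>i\<ge>a. i < b \<and> P i \<and> \<not> P (Suc i)"
    using assms(3) assms(2)
  proof (induction b)
    case (Suc b)
    show ?case
    proof (cases "P b")
      case True
      then show ?thesis using Suc.prems by (intro exI[of _ b]) auto
    next
      case False
      with assms(1) Suc.prems have "a < b" by (metis less_antisym)
      with Suc.IH False show ?thesis by (auto intro: less_SucI)
    qed
  qed simp
  then show ?thesis using that by blast
qed

lemma alternating_values:
  fixes y :: "nat \<Rightarrow> 'k::ring_1"
  assumes "\<And>k. Suc (Suc k) \<le> m \<Longrightarrow> y (Suc (Suc k)) = - y k"
  shows "2 * j + d \<le> m \<Longrightarrow> y (2 * j + d) = (- 1) ^ j * y d"
proof (induction j)
  case (Suc j)
  then show ?case using assms[of "2 * j + d"] by simp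
qed simp

text \<open>Indexing is periodic on all naturals, so the cyclic successor is \<open>Suc\<close> and
  a rotation is a shift.\<close>

definition cyc_nth :: "'a list \<Rightarrow> nat \<Rightarrow> 'a" where
  "cyc_nth us k = us ! (k mod length us)"

lemma cyc_nth_less: "k < length us \<Longrightarrow> cyc_nth us k = us ! k"
  by (simp add: cyc_nth_def)

lemma cyc_nth_add_length [simp]: "cyc_nth us (k + length us) = cyc_nth us k"
  by (simp add: cyc_nth_def)

lemma cyc_nth_length [simp]: "cyc_nth us (length us) = cyc_nth us 0"
  by (simp add: cyc_nth_def)

lemma cyc_nth_in_set [simp]: "us \<noteq> [] \<Longrightarrow> cyc_nth us k \<in> set us"
  by (simp add: cyc_nth_def)

lemma set_conv_cyc_nth: "set us = cyc_nth us ` {..<length us}"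
  by (auto simp: set_conv_nth cyc_nth_less image_iff)

lemma cyc_nth_rotate: "us \<noteq> [] \<Longrightarrow> cyc_nth (rotate n us) k = cyc_nth us (n + k)"
  by (simp add: cyc_nth_def nth_rotate mod_add_right_eq)

lemma cyc_nth_eq_iff:
  "distinct us \<Longrightarrow> us \<noteq> [] \<Longrightarrow> cyc_nth us k = cyc_nth us l \<longleftrightarrow> k mod length us = l mod length us"
  by (simp add: cyc_nth_def nth_eq_iff_index_eq)

lemma cyc_nth_neq_2:
  assumes "distinct us" "length us \<ge> 3"
  shows "cyc_nth us k \<noteq> cyc_nth us (Suc (Suc k))"
proof
  have "us \<noteq> []" using assms by auto
  moreover assume "cyc_nth us k = cyc_nth us (Suc (Suc k))"
  ultimately have "length us dvd Suc (Suc k) - k"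
    using assms by (metis cyc_nth_eq_iff le_add2 mod_eq_dvd_iff_nat add_2_eq_Suc)
  then have "length us dvd 2" by simp
  then show False using assms(2) by (auto dest: dvd_imp_le)
qed

text \<open>A position of the form \<open>Suc k\<close> gives the two cycle neighbours the positions
  \<open>k\<close> and \<open>Suc (Suc k)\<close>, with no subtraction. The vertex at position 0 is
  met again at \<open>length us\<close>.\<close>

lemma in_set_cyc_nth_Suc:
  assumes "v \<in> set us"
  obtains k where "v = cyc_nth us (Suc k)"
proof -
  obtain i where i: "i < length us" "v = us ! i" using assms by (auto simp: in_set_conv_nth)
  moreover have "Suc (i + (length us - 1)) = i + length us" using i by simp
  ultimately have "v = cyc_nth us (Suc (i + (length us - 1)))"
    by (simp only: cyc_nth_add_length cyc_nth_less)
  then show ?thesis using that by blast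
qed

section \<open>Cycles in the matrix and the kernel equations along them\<close>

context gain_matrix
begin

text \<open>Only consecutive adjacencies are prescribed; chords are permitted.\<close>

definition closed_cycle :: "'a list \<Rightarrow> bool" where
  "closed_cycle us \<longleftrightarrow> length us \<ge> 3 \<and> distinct us \<and>
     (\<forall>k. A (cyc_nth us k) (cyc_nth us (Suc k)) \<noteq> 0)"

definition path_gain :: "'a list \<Rightarrow> nat \<Rightarrow> 'k" where
  "path_gain us k = prod_list (map (\<lambda>i. A (cyc_nth us i) (cyc_nth us (Suc i))) [0..<k])"

definition type1 :: "'a list \<Rightarrow> bool" where
  "type1 us \<longleftrightarrow> even (length us) \<and> path_gain us (length us) = (- 1) ^ (length us div 2)"

text \<open>Position 0 is the root, the only vertex through which the cycle may meet the rest of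
  \<open>S\<close>, and its degree is left open. Chords are excluded, since one end of a chord would
  not be the root.\<close>

definition pendant_cycle :: "'a set \<Rightarrow> 'a list \<Rightarrow> bool" where
  "pendant_cycle S us \<longleftrightarrow> closed_cycle us \<and> set us \<subseteq> S \<and>
     (\<forall>k. Suc k < length us \<longrightarrow> nbrs S (cyc_nth us (Suc k)) = {cyc_nth us k, cyc_nth us (Suc (Suc k))})"

text \<open>Dividing by the gain of the path from the first vertex turns the kernel equation at each vertex
  of degree 2 of the cycle into \<open>y (k + 2) = - y k\<close>, whatever the gains are.\<close>

definition gauged :: "'a list \<Rightarrow> ('a \<Rightarrow> 'k) \<Rightarrow> nat \<Rightarrow> 'k" where
  "gauged us x k = x (cyc_nth us k) * inverse (path_gain us k)"

lemma closed_cycle_nonempty: "closed_cycle us \<Longrightarrow> us \<noteq> []"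
  by (auto simp: closed_cycle_def)

lemma closed_cycle_rotate: "closed_cycle us \<Longrightarrow> closed_cycle (rotate n us)"
  using closed_cycle_nonempty[of us] by (simp add: closed_cycle_def cyc_nth_rotate)

lemma path_gain_0 [simp]: "path_gain us 0 = 1"
  by (simp add: path_gain_def)

lemma path_gain_Suc:
  "path_gain us (Suc k) = path_gain us k * A (cyc_nth us k) (cyc_nth us (Suc k))"
  by (simp add: path_gain_def)

lemma path_gain_nonzero: "closed_cycle us \<Longrightarrow> path_gain us k \<noteq> 0"
  by (induction k) (auto simp: path_gain_Suc closed_cycle_def)

lemma gauged_eq_0_iff: "closed_cycle us \<Longrightarrow> gauged us x k = 0 \<longleftrightarrow> x (cyc_nth us k) = 0"
  by (simp add: gauged_def path_gain_nonzero)

text \<open>Let a and b be the gains from position k to k+1 and from k+1 to k+2. The equation x_k a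
  + x_(k+2) b^-1 = 0 is multiplied on the right by a^-1 and the inverse of the path gain. The gauge
  acts on the right because kernel coefficients stand on the left.\<close>

lemma gauged_step_iff:
  assumes "closed_cycle us"
  shows "x (cyc_nth us k) * A (cyc_nth us k) (cyc_nth us (Suc k)) +
      x (cyc_nth us (Suc (Suc k))) * A (cyc_nth us (Suc (Suc k))) (cyc_nth us (Suc k)) = 0
    \<longleftrightarrow> gauged us x (Suc (Suc k)) = - gauged us x k"
proof -
  define a b where "a = A (cyc_nth us k) (cyc_nth us (Suc k))"
    and "b = A (cyc_nth us (Suc k)) (cyc_nth us (Suc (Suc k)))"
  let ?P = "path_gain us k"
  have nz: "?P \<noteq> 0" "a \<noteq> 0" "b \<noteq> 0"
    using assms path_gain_nonzero by (auto simp: a_def b_def closed_cycle_def)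
  have "path_gain us (Suc (Suc k)) = ?P * a * b"
    by (simp add: path_gain_Suc a_def b_def)
  then have 1: "gauged us x (Suc (Suc k)) =
      x (cyc_nth us (Suc (Suc k))) * inverse b * (inverse a * inverse ?P)"
    using nz by (simp add: gauged_def nonzero_inverse_mult_distrib mult.assoc)
  have "a * (inverse a * inverse ?P) = inverse ?P"
    using nz by (simp add: mult.assoc[symmetric])
  then have 2: "- gauged us x k = - (x (cyc_nth us k) * a) * (inverse a * inverse ?P)"
    by (simp add: gauged_def mult.assoc)
  show ?thesis
    using nz inv[of "cyc_nth us (Suc (Suc k))" "cyc_nth us (Suc k)"] unfolding 1 2 mult_cancel_right
    by (simp add: a_def[symmetric] b_def[symmetric] eq_neg_iff_add_eq_0 add.commute)
qed

lemma sum_column: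
  assumes "finite S" "nbrs S v = U"
  shows "(\<Sum>i\<in>S. x i * A i v) = (\<Sum>i\<in>U. x i * A i v)"
proof (rule sum.mono_neutral_right)
  show "\<forall>i\<in>S - U. x i * A i v = 0" using assms(2) adj_sym[of v] by (auto simp: nbrs_def)
qed (use assms in \<open>auto simp: nbrs_def\<close>)

lemma pendant_cycle_column:
  assumes "finite S" "pendant_cycle S us" "Suc k < length us"
  shows "(\<Sum>i\<in>S. x i * A i (cyc_nth us (Suc k))) =
    x (cyc_nth us k) * A (cyc_nth us k) (cyc_nth us (Suc k)) +
      x (cyc_nth us (Suc (Suc k))) * A (cyc_nth us (Suc (Suc k))) (cyc_nth us (Suc k))"
proof -
  have "cyc_nth us k \<noteq> cyc_nth us (Suc (Suc k))"
    using assms(2) by (intro cyc_nth_neq_2) (auto simp: pendant_cycle_def closed_cycle_def)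
  moreover have "nbrs S (cyc_nth us (Suc k)) = {cyc_nth us k, cyc_nth us (Suc (Suc k))}"
    using assms by (auto simp: pendant_cycle_def)
  ultimately show ?thesis using sum_column[OF assms(1)] by simp
qed

lemma gauged_kernel:
  assumes "finite S" "pendant_cycle S us"
    and "\<And>k. Suc k < length us \<Longrightarrow> (\<Sum>i\<in>S. x i * A i (cyc_nth us (Suc k))) = 0"
    and "2 * j + d \<le> length us"
  shows "gauged us x (2 * j + d) = (- 1) ^ j * gauged us x d"
proof (rule alternating_values[OF _ assms(4)])
  fix k assume "Suc (Suc k) \<le> length us"
  then show "gauged us x (Suc (Suc k)) = - gauged us x k"
    using assms(1-3) pendant_cycle_column[OF assms(1,2), of k x] gauged_step_iff[of us x k]
    by (simp add: pendant_cycle_def)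
qed

text \<open>These are the two contributions of the cycle to the column of its root. For a nonzero
  value at position 1 they cancel iff the cycle gain is \<open>(- 1) ^ Suc j\<close>, which for
  length \<open>2 * j + 2\<close> is the Type 1 condition.\<close>

lemma gauged_close:
  assumes "closed_cycle us" "length us = 2 * j + 2"
    and "gauged us x (2 * j + 1) = (- 1) ^ j * gauged us x 1"
  shows "x (cyc_nth us 1) * A (cyc_nth us 1) (cyc_nth us 0) +
      x (cyc_nth us (2 * j + 1)) * A (cyc_nth us (2 * j + 1)) (cyc_nth us 0) =
      gauged us x 1 * (1 - (- 1) ^ Suc j * path_gain us (length us))"
proof -
  have 1: "x (cyc_nth us 1) * A (cyc_nth us 1) (cyc_nth us 0) = gauged us x 1"
    using inv[of "cyc_nth us 1" "cyc_nth us 0"] by (simp add: gauged_def path_gain_Suc)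
  have "x (cyc_nth us (2 * j + 1)) = gauged us x (2 * j + 1) * path_gain us (2 * j + 1)"
    using path_gain_nonzero[OF assms(1), of "2 * j + 1"] by (simp add: gauged_def mult.assoc)
  then have "x (cyc_nth us (2 * j + 1)) * A (cyc_nth us (2 * j + 1)) (cyc_nth us 0)
      = gauged us x (2 * j + 1) * path_gain us (length us)"
    using path_gain_Suc[of us "2 * j + 1"] cyc_nth_length[of us] assms(2) by (simp add: mult.assoc)
  also have "\<dots> = gauged us x 1 * ((- 1) ^ j * path_gain us (length us))"
  proof -
    have "(- 1) ^ j * gauged us x 1 = gauged us x 1 * (- 1) ^ j"
      by (cases "even j") auto
    then show ?thesis unfolding assms(3) by (simp add: mult.assoc)
  qed
  finally show ?thesis using 1 by (simp add: algebra_simps)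
qed

lemma adj_cycle:
  assumes "closed_cycle us"
  shows "A (cyc_nth us k) (cyc_nth us (Suc k)) \<noteq> 0" "A (cyc_nth us (Suc k)) (cyc_nth us k) \<noteq> 0"
  using assms adj_sym[of "cyc_nth us k" "cyc_nth us (Suc k)"] by (auto simp: closed_cycle_def)

lemma cycle_nbrs:
  assumes "closed_cycle us" "set us \<subseteq> S"
  shows "{cyc_nth us k, cyc_nth us (Suc (Suc k))} \<subseteq> nbrs S (cyc_nth us (Suc k))"
  using adj_cycle[OF assms(1)] assms closed_cycle_nonempty[of us] by (auto simp: nbrs_def)

lemma cycle_deg_ge_2:
  assumes "finite S" "closed_cycle us" "set us \<subseteq> S" "v \<in> set us"
  shows "deg S v \<ge> 2"
proof -
  obtain k where k: "v = cyc_nth us (Suc k)" using assms(4) by (rule in_set_cyc_nth_Suc)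
  have "card {cyc_nth us k, cyc_nth us (Suc (Suc k))} = 2"
    using assms(2) by (subst card_2_iff) (auto simp: closed_cycle_def dest: cyc_nth_neq_2)
  then show ?thesis unfolding k using card_mono[OF _ cycle_nbrs[OF assms(2,3), of k]] assms(1) by simp
qed

section \<open>Searches that stop in front of a cycle or of one of its vertices\<close>

definition component :: "'a set \<Rightarrow> 'a \<Rightarrow> 'a set" where
  "component U l = {v. (l, v) \<in> {(a, b). a \<in> U \<and> b \<in> U \<and> A a b \<noteq> 0}\<^sup>*}"

lemma component_refl: "l \<in> component U l"
  by (simp add: component_def)

lemma component_step: "u \<in> component U l \<Longrightarrow> u \<in> U \<Longrightarrow> v \<in> U \<Longrightarrow> A u v \<noteq> 0 \<Longrightarrow> v \<in> component U l"
  unfolding component_def by (auto intro: rtrancl_into_rtrancl)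

lemma component_subset:
  assumes "l \<in> U"
  shows "component U l \<subseteq> U"
proof
  fix v assume "v \<in> component U l"
  then have "(l, v) \<in> {(a, b). a \<in> U \<and> b \<in> U \<and> A a b \<noteq> 0}\<^sup>*" by (simp add: component_def)
  then show "v \<in> U" by (induction rule: rtrancl_induct) (use assms in auto)
qed

lemma reaches_component:
  assumes "l \<in> U"
  shows "reaches {l} (component U l)"
  unfolding reaches_def
proof (intro conjI allI impI)
  fix Q assume Q: "{l} \<subseteq> Q" "Q \<subset> component U l"
  show "\<exists>u\<in>Q. \<exists>v\<in>component U l - Q. A u v \<noteq> 0"
  proof (rule ccontr)
    assume no: "\<not> ?thesis"
    have "v \<in> Q" if "(l, v) \<in> {(a, b). a \<in> U \<and> b \<in> U \<and> A a b \<noteq> 0}\<^sup>*" for v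
      using that
    proof (induction rule: rtrancl_induct)
      case (step a b)
      have "a \<in> component U l" using step(3) Q by blast
      then have "b \<in> component U l" using step(2) component_step[of a U l b] by auto
      then show ?case using no \<open>(a, b) \<in> _\<close> \<open>a \<in> Q\<close> by auto
    qed (use Q in simp)
    then show False using Q by (auto simp: component_def)
  qed
qed (simp add: component_refl)

text \<open>Without position \<open>k\<close> the cycle consists of two arms that leave position 0,
  one upwards to k-1 and one downwards from \<open>length us\<close> to k+1. A vertex missing from
  \<open>Q\<close> lies on one arm, and somewhere between it and the root the arm crosses the border
  of \<open>Q\<close>.\<close>

lemma reaches_cycle_minus_vertex:
  assumes us: "closed_cycle us" "0 < k" "k < length us"
    and X: "reaches {l} X" "X \<inter> set us = {}" "u \<in> X" "A u (cyc_nth us 0) \<noteq> 0"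
  shows "reaches {l} (X \<union> (set us - {cyc_nth us k}))"
  unfolding reaches_def
proof (intro conjI allI impI)
  let ?m = "length us" and ?W = "X \<union> (set us - {cyc_nth us k})"
  have ne: "us \<noteq> []" using us(1) by (rule closed_cycle_nonempty)
  have inj: "cyc_nth us i = cyc_nth us j \<longleftrightarrow> i mod ?m = j mod ?m" for i j
    using us(1) ne by (simp add: closed_cycle_def cyc_nth_eq_iff)
  show "{l} \<subseteq> ?W" using X by (auto simp: reaches_def)
  fix Q assume Q: "{l} \<subseteq> Q" "Q \<subset> ?W"
  show "\<exists>u\<in>Q. \<exists>v\<in>?W - Q. A u v \<noteq> 0"
  proof (cases "X \<subseteq> Q")
    case False
    then have "{l} \<subseteq> Q \<inter> X" "Q \<inter> X \<subset> X" using Q X by (auto simp: reaches_def)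
    then obtain a b where "a \<in> Q \<inter> X" "b \<in> X - Q \<inter> X" "A a b \<noteq> 0"
      using X(1) unfolding reaches_def by blast
    then show ?thesis by blast
  next
    case True
    have r: "cyc_nth us 0 \<in> ?W" using us ne inj[of 0 k] by simp
    show ?thesis
    proof (cases "cyc_nth us 0 \<in> Q")
      case False
      then show ?thesis using r X True by blast
    next
      case rQ: True
      obtain z where z: "z \<in> set us" "z \<noteq> cyc_nth us k" "z \<notin> Q" using True Q by blast
      then obtain j where j: "j < ?m" "z = cyc_nth us j" unfolding set_conv_cyc_nth by blast
      have jk: "j \<noteq> k" using j z by auto
      have "j \<noteq> 0" using j z rQ by (intro notI) simp
      then have j0: "0 < j" by simp
      show ?thesis
      proof (cases "j < k")
        case True
        obtain i where i: "i < j" "cyc_nth us i \<in> Q" "cyc_nth us (Suc i) \<notin> Q"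
          using nat_crossing[of "\<lambda>i. cyc_nth us i \<in> Q" 0 j] rQ z j j0 by blast
        then have "cyc_nth us (Suc i) \<in> ?W" using inj[of "Suc i" k] True us ne by simp
        then show ?thesis using i adj_cycle[OF us(1), of i] by blast
      next
        case False
        \<comment> \<open>On the downward arm the root is met as position \<open>?m\<close>, and the
          crossing arc is used backwards, from \<open>Suc i\<close> to \<open>i\<close>.\<close>
        obtain i where i: "j \<le> i" "i < ?m" "cyc_nth us i \<notin> Q" "cyc_nth us (Suc i) \<in> Q"
          using nat_crossing[of "\<lambda>i. cyc_nth us i \<notin> Q" j ?m] rQ z j by auto
        then have "cyc_nth us i \<in> ?W" using inj[of i k] False jk us ne by simp
        then show ?thesis using i adj_cycle[OF us(1), of i] by blast
      qed
    qed
  qed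
qed

text \<open>The cycle is rotated so that it starts at a vertex \<open>r\<close> adjacent to the part
  \<open>X\<close> that the leaf reaches without entering the cycle. Each claimed property is
  obtained from an order of processing that would beat the bound if the property failed.\<close>

lemma extremal_pendant_cycle:
  assumes S: "finite S" "linked S" "l \<in> S" "deg S l = 1"
    and max: "left_nullity A S S = bnd S"
    and us: "closed_cycle us" "set us \<subseteq> S"
  obtains vs where "pendant_cycle S vs" "set vs = set us" "type1 vs" "deg S (cyc_nth vs 0) = 3"
proof -
  define X where "X = component (S - set us) l"
  \<comment> \<open>A leaf has degree 1, a vertex of a cycle at least 2.\<close>
  have lU: "l \<in> S - set us" using cycle_deg_ge_2[OF S(1) us, of l] S by auto
  have X: "X \<subseteq> S - set us" "reaches {l} X"
    unfolding X_def using component_subset[OF lU] reaches_component[OF lU] by auto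
  have lX: "l \<in> X" by (simp add: X_def component_refl)
  have ne: "us \<noteq> []" using us(1) by (rule closed_cycle_nonempty)
  then have "cyc_nth us 0 \<in> S - X" using X us cyc_nth_in_set[of us 0] by blast
  then have "X \<subset> S" using X(1) by blast
  then obtain u r where ur: "u \<in> X" "r \<in> S - X" "A u r \<noteq> 0"
    using S(2) lX unfolding linked_def by blast
  have "r \<in> set us"
  proof (rule ccontr)
    assume "r \<notin> set us"
    with ur X(1) have "r \<in> X" unfolding X_def using component_step[of u "S - set us" l r] by blast
    with ur show False by simp
  qed
  then obtain n where n: "r = cyc_nth us (Suc n)" by (rule in_set_cyc_nth_Suc)
  define vs where "vs = rotate (Suc n) us"
  have vs: "closed_cycle vs" "set vs = set us" "cyc_nth vs 0 = r"
    using closed_cycle_rotate[OF us(1), of "Suc n"] n cyc_nth_rotate[OF ne, of "Suc n" 0] by (auto simp: vs_def)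
  let ?m = "length vs"
  have m: "?m \<ge> 3" "distinct vs" and vne: "vs \<noteq> []"
    using vs(1) ne by (auto simp: closed_cycle_def vs_def)
  have vS: "set vs \<subseteq> S" using vs us by simp
  have inj: "cyc_nth vs i = cyc_nth vs j \<longleftrightarrow> i mod ?m = j mod ?m" for i j
    using m vne by (simp add: cyc_nth_eq_iff)
  have rad: "A u (cyc_nth vs 0) \<noteq> 0" using ur vs by simp
  have Xvs: "X \<inter> set vs = {}" using X vs by blast
  have pendant: "pendant_cycle S vs"
    unfolding pendant_cycle_def
  proof (intro conjI allI impI)
    fix k assume k: "Suc k < ?m"
    let ?v = "cyc_nth vs (Suc k)" and ?D = "{cyc_nth vs k, cyc_nth vs (Suc (Suc k))}"
    \<comment> \<open>\<open>?v\<close> is processed after the rest of the cycle, so both its cycle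
      neighbours are zero by then and its cost is at most the truncated deg - 3. Equality in the
      bound leaves only degree 2.\<close>
    let ?W = "X \<union> (set vs - {?v})"
    have D: "?D \<subseteq> nbrs S ?v" by (rule cycle_nbrs[OF vs(1) vS])
    have D2: "card ?D = 2" using cyc_nth_neq_2[of vs k] m by simp
    have DW: "?D \<subseteq> ?W"
      using inj[of k "Suc k"] inj[of "Suc k" "Suc (Suc k)"] k m vne
      by (cases "Suc (Suc k) = ?m") auto
    define I where "I = S - ?W - nbhd S ?W"
    have "left_nullity A S S + (deg S ?v - 2) \<le> bnd S + 0 + (card (nbrs S ?v \<inter> I) - 1)"
    proof (rule leaf_forcing[OF S(1,2) _ S(3,4)])
      show "reaches {l} ?W"
        by (rule reaches_cycle_minus_vertex[OF vs(1) _ k X(2) Xvs ur(1) rad]) simp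
      show "cyc_nth vs k \<in> ?W" using DW by simp
      show "A (cyc_nth vs k) ?v \<noteq> 0" by (rule adj_cycle[OF vs(1)])
    qed (use X vS vne Xvs in \<open>auto simp: I_def disjoint_iff\<close>)
    moreover have "card (nbrs S ?v \<inter> I) + card ?D \<le> deg S ?v"
      using DW by (intro card_Diff_Int_le) (use D S in \<open>auto simp: I_def\<close>)
    ultimately have "deg S ?v \<le> card ?D" using max D2 by simp
    then show "nbrs S ?v = ?D" using D S(1) card_seteq[of "nbrs S ?v" ?D] by simp
  qed (use vs vS in auto)

  define a b where "a = cyc_nth vs 1" and "b = cyc_nth vs (?m - 1)"
  have r: "r = cyc_nth vs 0" "r \<in> S - X" using vs ur by auto
  have ab: "a \<noteq> b" "a \<in> set vs" "b \<in> set vs" "a \<noteq> r" "b \<noteq> r"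
    using inj[of 1 "?m - 1"] inj[of 1 0] inj[of "?m - 1" 0] m vne by (auto simp: a_def b_def r)
  have nr: "{u, a, b} \<subseteq> nbrs S r"
    using adj_cycle[OF vs(1), of 0] adj_cycle[OF vs(1), of "?m - 1"] rad adj_sym[of u r] ur(1,3) X vS ab vne
    by (auto simp: nbrs_def r a_def b_def)
  have nab: "u \<noteq> a" "u \<noteq> b" using ab Xvs ur by auto
  then have c3: "card {u, a, b} = 3" "card {u, a} = 2" using ab by auto
  have fnr: "finite (nbrs S r)" using S by simp
  have d3: "deg S r \<ge> 3" using card_mono[OF fnr nr] c3 by simp
  \<comment> \<open>The coordinates still free when the search has exhausted \<open>X\<close> but
    not yet processed \<open>r\<close>; being adjacent to \<open>X\<close>, \<open>r\<close> itself
    is already zero.\<close>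
  define I where "I = S - X - nbhd S X"
  have fI: "finite I" using S by (simp add: I_def)
  have rI: "r \<notin> I" using ur by (auto simp: I_def nbhd_def nbrs_def)
  have uI: "u \<notin> I" using ur by (auto simp: I_def)
  have forcing: "deg S r - 2 \<le> t + (card (nbrs S r \<inter> J) - 1)"
    if "J \<subseteq> I" "left_nullity A S I \<le> t + left_nullity A S J" for J t
    using leaf_forcing[OF S(1,2) _ S(3,4) X(2) r(2) ur(1,3) that[unfolded I_def]] X max by auto
  have gauge: "gauged vs x (2 * j + d) = (- 1) ^ j * gauged vs x d"
    if J: "J \<subseteq> I" and x: "\<And>i. i \<notin> J \<Longrightarrow> x i = 0" "\<And>j. j \<in> S \<Longrightarrow> (\<Sum>i\<in>J. x i * A i j) = 0"
      and "2 * j + d \<le> ?m" for J x j d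
  proof (rule gauged_kernel[OF S(1) pendant])
    fix k assume "Suc k < ?m"
    have "(\<Sum>i\<in>S. x i * A i (cyc_nth vs (Suc k))) = (\<Sum>i\<in>J. x i * A i (cyc_nth vs (Suc k)))"
      using J x(1) S(1) by (intro sum.mono_neutral_right) (auto simp: I_def)
    also have "\<dots> = 0" using vne vS by (intro x(2)) auto
    finally show "(\<Sum>i\<in>S. x i * A i (cyc_nth vs (Suc k))) = 0" .
  qed fact

  \<comment> \<open>If \<open>a\<close> were forced to zero for free, then \<open>r\<close> would
    have the two zero neighbours \<open>u\<close> and \<open>a\<close>, and its cost would fall
    below deg r - 2, which is positive as deg r is at least 3. Hence some kernel vector is nonzero
    at \<open>a\<close>.\<close>
  have "\<not> left_nullity A S I \<le> left_nullity A S (I - {a})"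
  proof
    assume "left_nullity A S I \<le> left_nullity A S (I - {a})"
    then have "deg S r - 2 \<le> 0 + (card (nbrs S r \<inter> (I - {a})) - 1)" by (intro forcing) auto
    moreover have "card (nbrs S r \<inter> (I - {a})) + card {u, a} \<le> deg S r"
      by (rule card_Diff_Int_le) (use S nr uI in auto)
    ultimately show False using c3 d3 by simp
  qed
  then obtain x where x: "\<And>i. i \<notin> I \<Longrightarrow> x i = 0" "\<And>j. j \<in> S \<Longrightarrow> (\<Sum>i\<in>I. x i * A i j) = 0" "x a \<noteq> 0"
    using left_nullity_forced[OF fI, of S A a] by blast
  have y: "gauged vs x (2 * j + d) = (- 1) ^ j * gauged vs x d" if "2 * j + d \<le> ?m" for j d
    by (rule gauge[OF subset_refl x(1,2) that])
  have y1: "gauged vs x 1 \<noteq> 0" using x(3) gauged_eq_0_iff[OF vs(1)] by (simp add: a_def)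
  \<comment> \<open>Position \<open>?m\<close> is \<open>r\<close> again. An odd length would put it
    in the same parity class as position 1, where the value is nonzero.\<close>
  have "gauged vs x ?m = 0" using gauged_eq_0_iff[OF vs(1)] x(1)[OF rI] r(1) by simp
  have "even ?m"
  proof (rule ccontr)
    assume "odd ?m"
    then have "2 * (?m div 2) + 1 = ?m" by simp
    with y[of "?m div 2" 1] y1 \<open>gauged vs x ?m = 0\<close> show False by simp
  qed
  then obtain q where "?m = 2 * q" by (rule evenE)
  then obtain j where j: "?m = 2 * j + 2" using m by (cases q) auto
  have b: "b = cyc_nth vs (2 * j + 1)" using j by (simp add: b_def)

  \<comment> \<open>Setting \<open>a\<close> to zero costs 1 and then forces \<open>b\<close> to
    zero as well, since \<open>b\<close> has an odd position. With \<open>u\<close>,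
    \<open>a\<close> and \<open>b\<close> gone, \<open>r\<close> costs at most the truncated deg -
    4. The total is below deg - 2 from degree 4 on, while degree 3 survives because of the
    truncation.\<close>
  have d: "deg S r = 3"
  proof (rule ccontr)
    assume "deg S r \<noteq> 3"
    then have d4: "deg S r \<ge> 4" using d3 by simp
    have "card (I \<inter> {a}) \<le> 1" using card_mono[of "{a}" "I \<inter> {a}"] by simp
    then have "left_nullity A S I \<le> 1 + left_nullity A S (I - {a})"
      using left_nullity_Diff[OF fI, of A S "{a}"] by simp
    also have "left_nullity A S (I - {a}) \<le> left_nullity A S (I - {a} - {b})"
    proof (rule left_nullity_forced)
      fix z assume z: "\<And>i. i \<notin> I - {a} \<Longrightarrow> z i = 0" "\<And>j. j \<in> S \<Longrightarrow> (\<Sum>i\<in>I - {a}. z i * A i j) = 0"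
      have "gauged vs z 1 = 0" using z(1)[of a] gauged_eq_0_iff[OF vs(1)] by (simp add: a_def)
      then have "gauged vs z (2 * j + 1) = 0" using gauge[of "I - {a}" z j 1] z j by auto
      then show "z b = 0" using gauged_eq_0_iff[OF vs(1)] b by simp
    qed (use fI in simp)
    finally have "deg S r - 2 \<le> 1 + (card (nbrs S r \<inter> (I - {a} - {b})) - 1)"
      by (intro forcing) auto
    moreover have "card (nbrs S r \<inter> (I - {a} - {b})) + card {u, a, b} \<le> deg S r"
      by (rule card_Diff_Int_le) (use S nr uI in auto)
    ultimately show False using c3 d4 by simp
  qed
  then have nr: "nbrs S r = {u, a, b}" using card_seteq[OF fnr nr] c3 by simp
  \<comment> \<open>\<open>u\<close> is already zero, so the column of \<open>r\<close> reduces to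
    the two cycle terms; as the value at position 1 is nonzero, their cancellation determines the
    gain.\<close>
  have "0 = (\<Sum>i\<in>I. x i * A i r)" using x(2) r by simp
  also have "\<dots> = (\<Sum>i\<in>S. x i * A i r)"
    using x(1) S(1) by (intro sum.mono_neutral_left) (auto simp: I_def)
  also have "\<dots> = x a * A a r + x b * A b r"
    unfolding sum_column[OF S(1) nr] using nab ab x(1)[OF uI] by simp
  also have "\<dots> = gauged vs x 1 * (1 - (- 1) ^ Suc j * path_gain vs ?m)"
    using gauged_close[OF vs(1) j y[of j 1]] j unfolding r(1) b by (simp add: a_def)
  finally have "1 - (- 1) ^ Suc j * path_gain vs ?m = 0" using y1 by simp
  then have "1 = (- 1) ^ Suc j * path_gain vs ?m" by (simp only: right_minus_eq)
  moreover have "(- 1) ^ Suc j = (1::'k) \<or> (- 1) ^ Suc j = (- 1::'k)"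
    by (cases "even j") auto
  ultimately have "path_gain vs ?m = (- 1) ^ Suc j"
    by (metis mult_1_left mult_minus1 minus_minus)
  then have "type1 vs" using j by (simp add: type1_def)
  then show ?thesis using that pendant vs d r by metis
qed

section \<open>Attaching a cycle of Type 1\<close>

text \<open>Positions 0 and \<open>length us\<close> name the same vertex but carry separately
  prescribed gauged values. They agree because the cycle gain of Type 1 is its own inverse and
  equals the sign demanded at position \<open>length us\<close>.\<close>

lemma alternating_on_cycle:
  assumes cc: "closed_cycle us" and t1: "type1 us"
  obtains w where "\<And>v. v \<notin> set us \<Longrightarrow> w v = 0"
    "\<And>k. k \<le> length us \<Longrightarrow> gauged us w k = (if k mod 2 = d then (- 1) ^ (k div 2) else 0)"
proof -
  let ?m = "length us"
  define ix where "ix = inv_into {..<?m} (cyc_nth us)"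
  define w where "w v = (if v \<in> set us \<and> ix v mod 2 = d
    then (- 1) ^ (ix v div 2) * path_gain us (ix v) else 0)" for v
  have ne: "us \<noteq> []" and "distinct us" using cc closed_cycle_nonempty by (auto simp: closed_cycle_def)
  then have "inj_on (cyc_nth us) {..<?m}" by (auto simp: inj_on_def cyc_nth_eq_iff)
  then have ix: "ix (cyc_nth us k) = k" if "k < ?m" for k
    using that by (simp add: ix_def)
  have less: "gauged us w k = (if k mod 2 = d then (- 1) ^ (k div 2) else 0)" if "k < ?m" for k
    using that ix ne path_gain_nonzero[OF cc] by (simp add: gauged_def w_def mult.assoc)
  have "gauged us w ?m = (if ?m mod 2 = d then (- 1) ^ (?m div 2) else 0)"
  proof -
    have "gauged us w ?m = gauged us w 0 * inverse (path_gain us ?m)"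
      by (simp add: gauged_def)
    moreover have "inverse ((- 1) ^ (?m div 2)) = ((- 1) ^ (?m div 2) :: 'k)"
      by (cases "even (?m div 2)") auto
    moreover have "?m mod 2 = 0" using t1 by (simp add: type1_def)
    ultimately show ?thesis
      using t1 ne less[of 0] by (cases "d = 0") (simp_all add: type1_def)
  qed
  with less that[of w] show ?thesis by (auto simp: w_def le_less)
qed

text \<open>A kernel vector on \<open>S\<close> is a kernel vector on \<open>T\<close>, continued
  along the even positions by an alternating vector scaled to its value at the root, plus a multiple
  of the alternating vector on the odd positions. The latter vanishes at the root and its terms in
  the column of the root cancel by Type 1; it is the extra dimension. In terms of rows,
  \<open>2 * j + 1\<close> new rows raise the rank by \<open>2 * j\<close>.\<close>

lemma left_nullity_type1_cycle:
  assumes fin: "finite S" and T: "S = T \<union> set us" "T \<inter> set us = {cyc_nth us 0}"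
    and us: "pendant_cycle S us" "type1 us"
  shows "left_nullity A S S = Suc (left_nullity A T T)"
proof -
  let ?m = "length us" and ?r = "cyc_nth us 0"
  have cc: "closed_cycle us" using us by (simp add: pendant_cycle_def)
  then have m: "?m \<ge> 3" "distinct us" "us \<noteq> []" using closed_cycle_nonempty by (auto simp: closed_cycle_def)
  obtain q where "?m = 2 * q" using us(2) by (auto simp: type1_def)
  with m obtain j where j: "?m = 2 * j + 2" by (cases q) auto
  have j1: "j \<ge> 1" using j m by simp
  have t1: "path_gain us ?m = (- 1) ^ Suc j" using us(2) j by (simp add: type1_def)
  have inj: "cyc_nth us i = cyc_nth us j \<longleftrightarrow> i = j" if "i < ?m" "j < ?m" for i j
    using m that by (simp add: cyc_nth_eq_iff)
  define Od Ev where "Od = (\<lambda>k. cyc_nth us (2 * k + 1)) ` {..j}"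
    and "Ev = (\<lambda>k. cyc_nth us (2 * k)) ` {..j}"
  have card: "card Od = Suc j" "card Ev = Suc j"
    unfolding Od_def Ev_def using j inj by (subst card_image; simp add: inj_on_def)+
  have OdI: "cyc_nth us (2 * k + 1) \<in> Od" if "k \<le> j" for k using that by (auto simp: Od_def)
  have rEv: "?r \<in> Ev" using imageI[of 0 "{..j}" "\<lambda>k. cyc_nth us (2 * k)"] by (simp add: Ev_def)
  have disj: "Od \<inter> Ev = {}"
  proof -
    have "cyc_nth us (2 * k + 1) \<noteq> cyc_nth us (2 * l)" if "k \<le> j" "l \<le> j" for k l
    proof -
      have "2 * k + 1 \<noteq> 2 * l" by presburger
      then show ?thesis using inj[of "2 * k + 1" "2 * l"] j that by simp
    qed
    then show ?thesis by (auto simp: Od_def Ev_def)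
  qed
  have un: "set us = Od \<union> Ev"
  proof
    show "set us \<subseteq> Od \<union> Ev"
    proof
      fix v assume "v \<in> set us"
      then obtain k where k: "k < ?m" "v = cyc_nth us k" unfolding set_conv_cyc_nth by blast
      show "v \<in> Od \<union> Ev"
      proof (cases "even k")
        case True
        then have "k = 2 * (k div 2)" "k div 2 \<le> j" using k j by auto
        then show ?thesis unfolding k(2) Ev_def by (metis UnI2 atMost_iff image_eqI)
      next
        case False
        then have "k = 2 * (k div 2) + 1" "k div 2 \<le> j" using k j by auto
        then show ?thesis unfolding k(2) Od_def by (metis UnI1 atMost_iff image_eqI)
      qed
    qed
    show "Od \<union> Ev \<subseteq> set us" using m by (auto simp: Od_def Ev_def)
  qed
  have rOd: "?r \<notin> Od" using disj rEv by blast
  have Tr: "v = ?r" if "v \<in> T" "v \<in> set us" for v using T(2) that by blast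
  have TO: "T \<inter> Od = {}" "T \<inter> Ev = {?r}" using Tr T(2) un rEv rOd by auto
  have finT: "finite T" and TS: "T \<subseteq> S" using fin T by simp_all
  have usS: "cyc_nth us n \<in> S" for n using T(1) m by simp
  have noadj: "A v w = 0" if vw: "v \<in> T" "w \<in> set us" "w \<noteq> ?r" "v \<noteq> ?r" for v w
  proof (rule ccontr)
    assume a: "A v w \<noteq> 0"
    obtain k where k: "k < ?m" "w = cyc_nth us k" using vw(2) unfolding set_conv_cyc_nth by blast
    with vw(3) obtain k' where k': "k = Suc k'" by (cases k) auto
    have "v \<in> nbrs S w" using a vw(1) T(1) adj_sym[of v w] by (simp add: nbrs_def)
    also have "nbrs S w \<subseteq> set us" using us(1) k k' m by (auto simp: pendant_cycle_def)
    finally show False using T(2) vw by blast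
  qed
  have rest: "(\<Sum>i\<in>S. x i * A i v) = (\<Sum>i\<in>T. x i * A i v)" if "v \<in> T" "v \<noteq> ?r" for x v
    using that T fin noadj[of v] adj_sym[of v] by (intro sum.mono_neutral_right) auto
  have root: "(\<Sum>i\<in>S. x i * A i ?r) = (\<Sum>i\<in>T. x i * A i ?r) +
     (x (cyc_nth us 1) * A (cyc_nth us 1) ?r + x (cyc_nth us (2 * j + 1)) * A (cyc_nth us (2 * j + 1)) ?r)" for x
  proof -
    let ?a = "cyc_nth us 1" and ?b = "cyc_nth us (2 * j + 1)"
    have ab: "?a \<noteq> ?b" "?a \<in> Od" "?b \<in> Od"
      using inj[of 1 "2 * j + 1"] j j1 OdI[of 0] OdI[of j] by auto
    have z: "A w ?r = 0" if w: "w \<in> set us" "w \<notin> {?a, ?b}" for w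
    proof (rule ccontr)
      assume a: "A w ?r \<noteq> 0"
      then have "w \<noteq> ?r" using diag by auto
      obtain k where k: "k < ?m" "w = cyc_nth us k" using w(1) unfolding set_conv_cyc_nth by blast
      with \<open>w \<noteq> ?r\<close> obtain k' where k': "k = Suc k'" by (cases k) auto
      have "?r \<in> nbrs S w" using a T(2) T(1) by (auto simp: nbrs_def)
      then have "?r = cyc_nth us k' \<or> ?r = cyc_nth us (Suc (Suc k'))"
        using us(1) k k' by (auto simp: pendant_cycle_def)
      moreover have "k' \<noteq> 0" using w k k' by (intro notI) simp
      moreover have "Suc (Suc k') \<noteq> ?m" using w k k' j by (intro notI) simp
      ultimately show False using inj[of 0 k'] inj[of 0 "Suc (Suc k')"] k k' m by auto
    qed
    have "(\<Sum>i\<in>S. x i * A i ?r) = (\<Sum>i\<in>T. x i * A i ?r) + (\<Sum>i\<in>S - T. x i * A i ?r)"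
      by (subst sum.subset_diff[OF TS fin]) (rule add.commute)
    also have "(\<Sum>i\<in>S - T. x i * A i ?r) = (\<Sum>i\<in>{?a, ?b}. x i * A i ?r)"
      using fin T TO ab un z by (intro sum.mono_neutral_right) auto
    finally show ?thesis using ab by simp
  qed
  have Scard: "card S = card T + (2 * j + 1)"
  proof -
    have "card S + card {?r} = card T + card (set us)"
      unfolding T(1) T(2)[symmetric] using finT by (intro card_Un_Int[symmetric]) auto
    then show ?thesis using j m distinct_card[of us] by simp
  qed

  have "row_left_rank A T T + 2 * j \<le> row_left_rank A S S"
  proof -
    obtain R where R: "R \<subseteq> T" "left_independent_rows A T R" "card R = row_left_rank A T T"
      using row_left_rank_attained[OF finT] .
    \<comment> \<open>Omitting position 1 switches off the odd alternating vector: all odd entries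
      vanish, the cycle drops out of the column of the root, and the restriction to \<open>T\<close>
      solves the equations of \<open>T\<close>. Whether the root is included is left to
      \<open>R\<close>.\<close>
    let ?D = "set us - {?r, cyc_nth us 1}"
    have "left_independent_rows A S (R \<union> ?D)"
    proof (rule left_independent_rowsI[OF fin])
      show "R \<union> ?D \<subseteq> S" using R T by auto
      fix x i
      assume x0: "\<And>i. i \<in> S - (R \<union> ?D) \<Longrightarrow> x i = 0"
        and k: "\<And>j. j \<in> S \<Longrightarrow> (\<Sum>i\<in>S. x i * A i j) = 0" and i: "i \<in> R \<union> ?D"
      have g: "gauged us x (2 * l + d) = (- 1) ^ l * gauged us x d" if "2 * l + d \<le> ?m" for l d
        by (rule gauged_kernel[OF fin us(1) k[OF usS] that])
      have a: "cyc_nth us 1 \<in> Od" using OdI[of 0] by simp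
      then have "cyc_nth us 1 \<in> S - (R \<union> ?D)" using R T un TO by auto
      then have "gauged us x 1 = 0" using x0 gauged_eq_0_iff[OF cc] by simp
      then have "gauged us x (2 * l + 1) = 0" if "l \<le> j" for l using g[of l 1] j that by simp
      then have od: "x v = 0" if "v \<in> Od" for v using that gauged_eq_0_iff[OF cc] by (auto simp: Od_def)
      have ab: "x (cyc_nth us 1) = 0" "x (cyc_nth us (2 * j + 1)) = 0" using od[OF a] od[OF OdI[of j]] by auto
      have R0: "x v = 0" if "v \<in> R" for v
      proof (rule left_independent_rowsD[OF R(2) finT R(1) _ _ that])
        fix v assume "v \<in> T - R"
        then show "x v = 0" using x0 T by blast
      next
        fix v assume "v \<in> T"
        then show "(\<Sum>i\<in>T. x i * A i v) = 0"
          using k[of v] rest[of v x] root[of x] ab T(1) by (cases "v = ?r") auto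
      qed
      have "x ?r = 0"
      proof (cases "?r \<in> R")
        case False
        then show ?thesis using T m by (intro x0) auto
      qed (rule R0)
      then have "gauged us x 0 = 0" using gauged_eq_0_iff[OF cc] by simp
      then have "gauged us x (2 * l) = 0" if "l \<le> j" for l using g[of l 0] j that by simp
      then have ev: "x v = 0" if "v \<in> Ev" for v using that gauged_eq_0_iff[OF cc] by (auto simp: Ev_def)
      show "x i = 0" using i R0 ev od un by blast
    qed
    moreover have "card (R \<union> ?D) = card R + 2 * j"
    proof -
      have "card (R \<union> ?D) = card R + card ?D"
        using R T finT finite_subset[of R T] by (intro card_Un_disjoint) auto
      moreover have "card ?D = card (set us) - card {?r, cyc_nth us 1}"
        using m by (intro card_Diff_subset) auto
      moreover have "cyc_nth us 1 \<noteq> ?r" using inj[of 1 0] m by simp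
      ultimately show ?thesis using j m distinct_card[of us] by simp
    qed
    ultimately show ?thesis using card_le_row_left_rank[OF fin, of "R \<union> ?D" A S] R T by auto
  qed
  moreover have "row_left_rank A S S \<le> row_left_rank A T T + 2 * j"
  proof -
    obtain R where R: "R \<subseteq> S" "left_independent_rows A S R" "card R = row_left_rank A S S"
      using row_left_rank_attained[OF fin] .
    have finR: "finite R" using R(1) fin finite_subset by blast
    have column: "(\<Sum>i\<in>S. w i * A i (cyc_nth us (Suc k))) = 0"
      if "Suc k < ?m" "\<And>k. k \<le> ?m \<Longrightarrow> gauged us w k = (if k mod 2 = d then (- 1) ^ (k div 2) else 0)" for w k d
    proof -
      have "gauged us w (Suc (Suc k)) = - gauged us w k" using that by simp
      then show ?thesis unfolding pendant_cycle_column[OF fin us(1) that(1)] gauged_step_iff[OF cc] .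
    qed
    \<comment> \<open>The odd alternating vector is a kernel vector supported on \<open>Od\<close>,
      so at least one odd row is missing from \<open>R\<close>.\<close>
    have "\<not> Od \<subseteq> R"
    proof
      assume Od: "Od \<subseteq> R"
      obtain w where w: "\<And>v. v \<notin> set us \<Longrightarrow> w v = 0"
        "\<And>k. k \<le> ?m \<Longrightarrow> gauged us w k = (if k mod 2 = 1 then (- 1) ^ (k div 2) else 0)"
        by (rule alternating_on_cycle[OF cc us(2), of 1]) blast
      have "gauged us w (2 * l) = 0" if "l \<le> j" for l using w(2)[of "2 * l"] that j by simp
      then have ev: "w v = 0" if "v \<in> Ev" for v using that gauged_eq_0_iff[OF cc] by (auto simp: Ev_def)
      have "w v = 0" if "v \<in> T" for v using that ev w(1) TO un rEv by (cases "v = ?r") auto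
      then have Tsum: "(\<Sum>i\<in>T. w i * A i v) = 0" for v by simp
      have "w (cyc_nth us 1) = 0"
      proof (rule left_independent_rowsD[OF R(2) fin R(1)])
        fix i assume "i \<in> S - R" then show "w i = 0" using Od ev w(1) un by blast
      next
        fix v assume v: "v \<in> S"
        show "(\<Sum>i\<in>S. w i * A i v) = 0"
        proof (cases "v \<in> T")
          case True
          have "gauged us w (2 * j + 1) = (- 1) ^ j * gauged us w 1"
            using w(2)[of "2 * j + 1"] w(2)[of 1] j by simp
          moreover have "(- 1) ^ j * (- 1) ^ j = (1::'k)" by (cases "even j") auto
          ultimately show ?thesis using gauged_close[OF cc j, of w] True rest[of v w] root[of w] Tsum t1 by (cases "v = ?r") auto
        next
          case False
          then obtain k where k: "k < ?m" "v = cyc_nth us k" using v T(1) unfolding set_conv_cyc_nth by blast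
          with False T(2) obtain k' where "k = Suc k'" by (cases k) auto
          then show ?thesis using column[OF _ w(2)] k by simp
        qed
      next
        show "cyc_nth us 1 \<in> R" using Od OdI[of 0] by auto
      qed
      moreover have "gauged us w 1 = 1" using w(2)[of 1] m by simp
      ultimately show False using gauged_eq_0_iff[OF cc, of w 1] by simp
    qed
    then have "card (R \<inter> Od) < card Od" by (intro psubset_card_mono) (auto simp: Od_def)
    then have cOd: "card (R \<inter> Od) \<le> j" using card by simp

    \<comment> \<open>\<open>E\<close> has at most \<open>j\<close> elements in both cases. If all
      even rows lie in \<open>R\<close>, the root is kept in \<open>R'\<close>. Otherwise a root in
      \<open>R\<close> is counted in \<open>E\<close>, and vectors supported in \<open>R'\<close>
      vanish at the root, so that their continuation along the cycle is zero.\<close>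
    define R' E where "R' = (if Ev \<subseteq> R then R \<inter> T else R \<inter> T - {?r})"
      and "E = (if Ev \<subseteq> R then Ev - {?r} else R \<inter> Ev)"
    have "card (R \<inter> Ev) < card Ev" if "\<not> Ev \<subseteq> R"
      using that by (intro psubset_card_mono) (auto simp: Ev_def)
    then have cE: "card E \<le> j" using card rEv by (cases "Ev \<subseteq> R") (simp_all add: E_def)
    have "R \<subseteq> R' \<union> (R \<inter> Od) \<union> E" using R(1) T un by (auto simp: R'_def E_def)
    then have "card R \<le> card (R' \<union> (R \<inter> Od) \<union> E)"
      using finR by (intro card_mono) (auto simp: R'_def E_def Ev_def)
    also have "\<dots> \<le> card R' + card (R \<inter> Od) + card E"
      by (rule order_trans[OF card_Un_le add_right_mono[OF card_Un_le]])
    finally have cR: "card R \<le> card R' + 2 * j" using cOd cE by simp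

    have "left_independent_rows A T R'"
    proof (rule left_independent_rowsI[OF finT])
      show R'T: "R' \<subseteq> T" by (auto simp: R'_def)
      fix x i
      assume x0: "\<And>i. i \<in> T - R' \<Longrightarrow> x i = 0"
        and k: "\<And>j. j \<in> T \<Longrightarrow> (\<Sum>i\<in>T. x i * A i j) = 0" and i: "i \<in> R'"
      obtain w where w: "\<And>v. v \<notin> set us \<Longrightarrow> w v = 0"
        "\<And>k. k \<le> ?m \<Longrightarrow> gauged us w k = (if k mod 2 = 0 then (- 1) ^ (k div 2) else 0)"
        by (rule alternating_on_cycle[OF cc us(2), of 0]) blast
      have "gauged us w (2 * l + 1) = 0" if "l \<le> j" for l using w(2)[of "2 * l + 1"] that j by simp
      then have od: "w v = 0" if "v \<in> Od" for v using that gauged_eq_0_iff[OF cc] by (auto simp: Od_def)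
      have wr: "w ?r = 1" using w(2)[of 0] by (simp add: gauged_def)
      \<comment> \<open>\<open>w\<close> is 1 at the root, hence the factor \<open>x ?r\<close>. It
        multiplies from the left and so preserves the column equations.\<close>
      define z where "z v = (if v \<in> T then x v else x ?r * w v)" for v
      have zus: "z v = x ?r * w v" if "v \<in> set us" for v
        using Tr[of v] that wr by (cases "v \<in> T") (simp_all add: z_def)
      have rT: "?r \<in> T" using T(2) by blast
      have xr: "x ?r = 0" if "\<not> Ev \<subseteq> R" using that x0[of ?r] rT by (auto simp: R'_def)
      have zT: "(\<Sum>i\<in>T. z i * A i v) = (\<Sum>i\<in>T. x i * A i v)" for v by (simp add: z_def)
      have iR: "i \<in> R" using i by (auto simp: R'_def split: if_splits)
      have "z i = 0"
      proof (rule left_independent_rowsD[OF R(2) fin R(1) _ _ iR])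
        fix v assume v: "v \<in> S - R"
        show "z v = 0"
        proof (cases "v \<in> T")
          case True
          then show ?thesis using v x0[of v] by (auto simp: z_def R'_def split: if_splits)
        next
          case False
          then show ?thesis using v T(1) un od xr by (auto simp: z_def)
        qed
      next
        fix v assume v: "v \<in> S"
        show "(\<Sum>i\<in>S. z i * A i v) = 0"
        proof (cases "v \<in> T")
          case True
          have "cyc_nth us 1 \<in> Od" "cyc_nth us (2 * j + 1) \<in> Od"
            using OdI[of 0] OdI[of j] by auto
          then have "z (cyc_nth us 1) = 0" "z (cyc_nth us (2 * j + 1)) = 0"
            using od TO by (auto simp: z_def)
          then show ?thesis using True k rest[of v z] root[of z] zT by (cases "v = ?r") auto
        next
          case False
          then obtain n where n: "n < ?m" "v = cyc_nth us n" using v T(1) unfolding set_conv_cyc_nth by blast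
          with False rT obtain n' where n': "n = Suc n'" by (cases n) auto
          have "(\<Sum>i\<in>S. z i * A i v) = x ?r * (\<Sum>i\<in>S. w i * A i v)"
            using n n' m zus unfolding n(2) n'
            by (simp add: pendant_cycle_column[OF fin us(1)] mult.assoc distrib_left)
          then show ?thesis using column[OF _ w(2)] n n' by simp
        qed
      qed
      then show "x i = 0" using i R'T by (auto simp: z_def)
    qed
    then have "card R' \<le> row_left_rank A T T"
      by (intro card_le_row_left_rank finT) (auto simp: R'_def)
    then show ?thesis using cR R(3) by simp
  qed
  ultimately show ?thesis
    using row_left_rank_plus_left_nullity[OF fin, of A S] row_left_rank_plus_left_nullity[OF finT, of A T] Scard
    by simp
qed

section \<open>Decomposition of extremal graphs\<close>

definition leaves :: "'a set \<Rightarrow> 'a set" where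
  "leaves S = {v \<in> S. deg S v = 1}"

definition acyclic_on :: "'a set \<Rightarrow> bool" where
  "acyclic_on S \<longleftrightarrow> (\<nexists>us. closed_cycle us \<and> set us \<subseteq> S)"

lemma linkedE:
  assumes "linked S" "Q \<noteq> {}" "Q \<subset> S"
  obtains u v where "u \<in> Q" "v \<in> S - Q" "A u v \<noteq> 0"
proof -
  from assms(1) have "Q \<noteq> {} \<longrightarrow> Q \<subset> S \<longrightarrow> (\<exists>u\<in>Q. \<exists>v\<in>S - Q. A u v \<noteq> 0)"
    unfolding linked_def by (elim conjE allE[of _ Q])
  with assms(2,3) that show ?thesis by blast
qed

lemma closed_cycleI:
  assumes "length us \<ge> 3" "distinct us"
    and "\<And>i. i < length us \<Longrightarrow> A (us ! i) (us ! (Suc i mod length us)) \<noteq> 0"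
  shows "closed_cycle us"
proof -
  have "A (cyc_nth us k) (cyc_nth us (Suc k)) \<noteq> 0" for k
  proof -
    have "k mod length us < length us" using assms(1) by (intro mod_less_divisor) linarith
    from assms(3)[OF this] show ?thesis by (simp add: cyc_nth_def mod_Suc_eq)
  qed
  then show ?thesis using assms by (simp add: closed_cycle_def)
qed

section \<open>Existence of cycles and degree sums of trees\<close>

lemma linked_deg_ge_1:
  assumes "finite S" "linked S" "card S \<ge> 2" "v \<in> S"
  shows "deg S v \<ge> 1"
proof -
  have "{v} \<subset> S" using assms by (auto simp: psubset_eq)
  then obtain u where "u \<in> S" "A v u \<noteq> 0" using assms(2) unfolding linked_def by blast
  then have "nbrs S v \<noteq> {}" by (auto simp: nbrs_def)
  then show ?thesis using assms(1) by (simp add: Suc_le_eq card_gt_0_iff)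
qed

text \<open>All neighbours of the first vertex of a longest path lie on the path. A neighbour other
  than the second vertex closes an initial segment of length at least 3 to a cycle.\<close>

lemma min_degree_2_cycle:
  assumes "finite S" "S \<noteq> {}" and deg: "\<And>v. v \<in> S \<Longrightarrow> deg S v \<ge> 2"
  obtains us where "closed_cycle us" "set us \<subseteq> S"
proof -
  define P where "P ps \<longleftrightarrow> ps \<noteq> [] \<and> distinct ps \<and> set ps \<subseteq> S \<and>
    (\<forall>i. Suc i < length ps \<longrightarrow> A (ps ! i) (ps ! Suc i) \<noteq> 0)" for ps
  obtain x where "x \<in> S" using assms by blast
  then have "P [x]" by (simp add: P_def)
  moreover have "length ps \<le> card S" if "P ps" for ps
    using that assms(1) card_mono[of S "set ps"] distinct_card[of ps] by (auto simp: P_def)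
  then have "\<forall>ps. P ps \<longrightarrow> length ps < Suc (card S)" by (simp add: le_imp_less_Suc)
  ultimately obtain ps where ps: "P ps" "\<And>qs. P qs \<Longrightarrow> length qs \<le> length ps"
    using ex_has_greatest_nat[of P "[x]" length "Suc (card S)"] by blast
  have p0: "ps ! 0 \<in> S" and ne: "ps \<noteq> []" using ps(1) by (auto simp: P_def)
  have nb: "w \<in> set ps" if w: "w \<in> nbrs S (ps ! 0)" for w
  proof (rule ccontr)
    assume "w \<notin> set ps"
    then have "P (w # ps)"
      using ps(1) w adj_sym[of w "ps ! 0"] by (auto simp: P_def nbrs_def nth_Cons split: nat.splits)
    from ps(2)[OF this] show False by simp
  qed
  \<comment> \<open>For a path with a single vertex \<open>ps ! 1\<close> is unspecified; this is
    harmless, as \<open>{ps ! 1}\<close> still has only one element.\<close>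
  have "\<not> nbrs S (ps ! 0) \<subseteq> {ps ! 1}"
    using deg[OF p0] card_mono[of "{ps ! 1}" "nbrs S (ps ! 0)"] by auto
  then obtain w where w: "w \<in> nbrs S (ps ! 0)" "w \<noteq> ps ! 1" by blast
  obtain i where i: "i < length ps" "w = ps ! i" using nb[OF w(1)] by (auto simp: in_set_conv_nth)
  have "i \<noteq> 0" using w(1) i diag by (intro notI) (simp add: nbrs_def)
  moreover have "i \<noteq> 1" using w(2) i by (intro notI) simp
  ultimately have i2: "i \<ge> 2" by simp
  have "closed_cycle (take (Suc i) ps)"
  proof (rule closed_cycleI)
    fix k assume "k < length (take (Suc i) ps)"
    then have k: "k \<le> i" using i by simp
    have len: "length (take (Suc i) ps) = Suc i" using i by simp
    show "A (take (Suc i) ps ! k) (take (Suc i) ps ! (Suc k mod length (take (Suc i) ps))) \<noteq> 0"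
    proof (cases "k = i")
      case True
      then show ?thesis using w(1) i adj_sym[of "ps ! 0" "ps ! i"] unfolding len by (simp add: nbrs_def)
    next
      case False
      then show ?thesis using k i ps(1) unfolding len by (simp add: P_def)
    qed
  qed (use i i2 ps(1) in \<open>auto simp: P_def\<close>)
  moreover have "set (take (Suc i) ps) \<subseteq> S" using ps(1) set_take_subset[of "Suc i" ps] by (auto simp: P_def)
  ultimately show ?thesis using that by blast
qed

text \<open>If the arc leaving \<open>Q\<close> ends in \<open>v\<close>, then \<open>u\<close> is
  in \<open>Q\<close>. The set \<open>insert v Q\<close> then has a leaving arc that cannot start in
  \<open>v\<close>, whose only neighbour is inside.\<close>

lemma linked_remove_leaf:
  assumes "linked S" "v \<in> S" "nbrs S v = {u}" "S \<noteq> {v}"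
  shows "linked (S - {v})"
  unfolding linked_def
proof (intro conjI allI impI)
  show "S - {v} \<noteq> {}" using assms by blast
  fix Q assume Q: "Q \<noteq> {}" "Q \<subset> S - {v}"
  then obtain a b where ab: "a \<in> Q" "b \<in> S - Q" "A a b \<noteq> 0"
    using assms(1) unfolding linked_def by blast
  show "\<exists>a\<in>Q. \<exists>b\<in>S - {v} - Q. A a b \<noteq> 0"
  proof (cases "b = v")
    case True
    then have "a \<in> nbrs S v" using ab Q adj_sym[of a v] by (auto simp: nbrs_def)
    then have u: "u \<in> Q" using ab assms(3) by simp
    have "insert v Q \<subset> S" using Q assms(2) by blast
    then obtain c d where cd: "c \<in> insert v Q" "d \<in> S - insert v Q" "A c d \<noteq> 0"
      using linkedE[OF assms(1), of "insert v Q"] by auto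
    have "c \<noteq> v"
    proof
      assume "c = v"
      then have "d \<in> nbrs S v" using cd by (simp add: nbrs_def)
      then show False using assms(3) u cd by simp
    qed
    then show ?thesis using cd by blast
  qed (use ab in blast)
qed

lemma acyclic_degree_sum:
  assumes "finite S" "linked S" "acyclic_on S"
  shows "(\<Sum>v\<in>S. deg S v) + 2 = 2 * card S"
  using assms
proof (induction "card S" arbitrary: S)
  case 0
  then show ?case by (simp add: linked_def)
next
  case (Suc n)
  show ?case
  proof (cases "card S \<ge> 2")
    case False
    then have "card S = 1" using Suc(2) by simp
    then obtain x where "S = {x}" by (rule card_1_singletonE)
    then show ?thesis using diag by (simp add: nbrs_def)
  next
    case True
    have "\<exists>v\<in>S. \<not> deg S v \<ge> 2"
    proof (rule ccontr)
      assume "\<not> ?thesis"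
      moreover have "S \<noteq> {}" using Suc.prems(2) by (simp add: linked_def)
      ultimately obtain us where "closed_cycle us" "set us \<subseteq> S"
        using min_degree_2_cycle[OF Suc.prems(1)] by blast
      then show False using Suc.prems(3) by (auto simp: acyclic_on_def)
    qed
    then obtain v where v: "v \<in> S" "deg S v = 1"
      using linked_deg_ge_1[OF Suc.prems(1,2) True] by (metis One_nat_def Suc_1 le_SucE not_less_eq_eq)
    then obtain u where u: "nbrs S v = {u}" by (metis card_1_singletonE)
    define T where "T = S - {v}"
    have vT: "S = insert v T" "v \<notin> T" "finite T" using v Suc.prems(1) by (auto simp: T_def)
    have "S \<noteq> {v}" using True by auto
    then have "linked T" unfolding T_def using Suc.prems(2) v u by (intro linked_remove_leaf) auto
    moreover have "acyclic_on T" using Suc.prems(3) by (auto simp: acyclic_on_def T_def)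
    ultimately have IH: "(\<Sum>v\<in>T. deg T v) + 2 = 2 * card T"
      using Suc(1)[of T] Suc(2) vT by simp
    have "u \<in> nbrs S v" using u by simp
    then have "u \<in> S" "A v u \<noteq> 0" by (auto simp: nbrs_def)
    then have uT: "u \<in> T" "A v u \<noteq> 0" using diag[of v] by (auto simp: T_def)
    have "deg S w = deg T w + (if w = u then 1 else 0)" if "w \<in> T" for w
    proof (cases "A w v = 0")
      case True
      then have "nbrs S w = nbrs T w" "w \<noteq> u" using vT uT adj_sym[of u v] by (auto simp: nbrs_def)
      then show ?thesis by simp
    next
      case False
      then have "w \<in> nbrs S v" using that vT adj_sym[of w v] by (simp add: nbrs_def)
      then have "w = u" using u by simp
      moreover have "nbrs S w = insert v (nbrs T w)" "v \<notin> nbrs T w" using False vT by (auto simp: nbrs_def)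
      ultimately show ?thesis using vT by simp
    qed
    then have "(\<Sum>w\<in>T. deg S w) = (\<Sum>w\<in>T. deg T w + (if w = u then 1 else 0))" by simp
    also have "\<dots> = (\<Sum>w\<in>T. deg T w) + 1" using uT vT by (simp add: sum.distrib)
    finally show ?thesis using IH v(2) vT by simp
  qed
qed

text \<open>Truncation replaces -1 by 0 at each leaf and changes nothing at degree 2 or more; this
  is how the number of leaves enters the bound.\<close>

lemma bnd_degree_sum:
  assumes "finite S" "linked S" "card S \<ge> 2"
  shows "bnd S + 2 * card S = 1 + (\<Sum>v\<in>S. deg S v) + card (leaves S)"
proof -
  have "(\<Sum>v\<in>S. deg S v - 2 + 2) = (\<Sum>v\<in>S. deg S v + (if deg S v = 1 then 1 else 0))"
    using linked_deg_ge_1[OF assms] by (intro sum.cong) force+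
  moreover have "card (leaves S) = (\<Sum>v\<in>S. if deg S v = 1 then 1 else 0)"
    using assms(1) by (simp add: leaves_def sum.If_cases Int_def)
  ultimately show ?thesis unfolding bnd_def by (simp only: sum.distrib sum_constant) simp
qed

section \<open>Removing pendant cycles until a tree is left\<close>

lemma pendant_cycle_nbrs:
  assumes "pendant_cycle S us" "w \<in> set us" "w \<noteq> cyc_nth us 0"
  obtains k where "Suc k < length us" "w = cyc_nth us (Suc k)"
    "nbrs S w = {cyc_nth us k, cyc_nth us (Suc (Suc k))}"
proof -
  obtain i where i: "i < length us" "w = cyc_nth us i"
    using assms(2) unfolding set_conv_cyc_nth by blast
  with assms(3) obtain k where "i = Suc k" by (cases i) auto
  with i assms(1) show ?thesis using that by (auto simp: pendant_cycle_def)
qed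

text \<open>The deleted vertices have degree 2 and contribute nothing to \<open>bnd\<close>. The
  root falls from degree 3 to degree 1, its share from 1 to 0, and it becomes a leaf.\<close>

lemma strip_cycle:
  assumes S: "finite S" "linked S" and us: "pendant_cycle S us" "deg S (cyc_nth us 0) = 3"
  defines "T \<equiv> S - (set us - {cyc_nth us 0})"
  shows "linked T" "deg T (cyc_nth us 0) = 1" "bnd S = Suc (bnd T)"
    "\<And>v. v \<in> T \<Longrightarrow> v \<noteq> cyc_nth us 0 \<Longrightarrow> nbrs T v = nbrs S v"
    "leaves T = insert (cyc_nth us 0) (leaves S)"
proof -
  let ?r = "cyc_nth us 0" and ?m = "length us"
  have cc: "closed_cycle us" and usS: "set us \<subseteq> S" using us(1) by (auto simp: pendant_cycle_def)
  have m: "?m \<ge> 3" "distinct us" "us \<noteq> []"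
    using cc closed_cycle_nonempty by (auto simp: closed_cycle_def)
  have r: "?r \<in> T" "?r \<in> set us" using m usS by (auto simp: T_def)
  have nb: "nbrs S w \<subseteq> set us" if w: "w \<in> set us" "w \<noteq> ?r" for w
    using m by (rule_tac pendant_cycle_nbrs[OF us(1) w]) auto
  have noadj: "A v w = 0" if "v \<in> T" "v \<noteq> ?r" "w \<in> set us" "w \<noteq> ?r" for v w
  proof (rule ccontr)
    assume "A v w \<noteq> 0"
    then have "v \<in> nbrs S w" using that adj_sym[of v w] by (simp add: nbrs_def T_def)
    with nb that show False by (auto simp: T_def)
  qed
  show nbT: "nbrs T v = nbrs S v" if "v \<in> T" "v \<noteq> ?r" for v
    using noadj[OF that] by (auto simp: nbrs_def T_def)
  show "linked T" unfolding linked_def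
  proof (intro conjI allI impI)
    show "T \<noteq> {}" using r by blast
    fix Q assume Q: "Q \<noteq> {}" "Q \<subset> T"
    \<comment> \<open>Completing \<open>Q\<close> by the whole cycle when it contains the root keeps
      the leaving arc off the deleted vertices.\<close>
    define Q' where "Q' = (if ?r \<in> Q then Q \<union> set us else Q)"
    have "Q' \<noteq> {}" "Q' \<subset> S" using Q r usS by (auto simp: Q'_def T_def)
    then obtain a b where ab: "a \<in> Q'" "b \<in> S - Q'" "A a b \<noteq> 0"
      using S(2) unfolding linked_def by blast
    have "a \<in> Q"
    proof (rule ccontr)
      assume "a \<notin> Q"
      then have a: "?r \<in> Q" "a \<in> set us" "a \<noteq> ?r" using ab(1) by (auto simp: Q'_def split: if_splits)
      then have "b \<in> set us" using nb[of a] ab by (auto simp: nbrs_def)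
      then show False using a ab by (simp add: Q'_def)
    qed
    moreover have "b \<in> T - Q"
    proof (rule ccontr)
      assume "b \<notin> T - Q"
      then have b: "b \<in> set us" "b \<noteq> ?r" using ab by (auto simp: Q'_def T_def split: if_splits)
      then have "a \<in> set us" using nb[of b] ab \<open>a \<in> Q\<close> Q adj_sym[of a b] by (auto simp: nbrs_def T_def)
      then have "a = ?r" using \<open>a \<in> Q\<close> Q by (auto simp: T_def)
      then show False using b ab \<open>a \<in> Q\<close> by (simp add: Q'_def)
    qed
    ultimately show "\<exists>u\<in>Q. \<exists>v\<in>T - Q. A u v \<noteq> 0" using ab(3) by blast
  qed
  let ?a = "cyc_nth us 1" and ?b = "cyc_nth us (?m - 1)"
  have inj: "cyc_nth us i = cyc_nth us j \<longleftrightarrow> i mod ?m = j mod ?m" for i j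
    using m by (simp add: cyc_nth_eq_iff)
  have ab: "?a \<noteq> ?b" "?a \<noteq> ?r" "?b \<noteq> ?r"
    using inj[of 1 "?m - 1"] inj[of 1 0] inj[of "?m - 1" 0] m by auto
  have abr: "{?a, ?b} \<subseteq> nbrs S ?r"
    using adj_cycle[OF cc, of 0] adj_cycle[OF cc, of "?m - 1"] m usS by (auto simp: nbrs_def)
  have only: "w \<in> {?a, ?b}" if w: "w \<in> set us" "w \<noteq> ?r" "w \<in> nbrs S ?r" for w
  proof (rule pendant_cycle_nbrs[OF us(1) w(1,2)])
    fix k assume k: "Suc k < ?m" "w = cyc_nth us (Suc k)" "nbrs S w = {cyc_nth us k, cyc_nth us (Suc (Suc k))}"
    have "?r \<in> nbrs S w" using w r usS adj_sym[of w ?r] by (auto simp: nbrs_def)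
    then have "cyc_nth us 0 = cyc_nth us k \<or> cyc_nth us 0 = cyc_nth us (Suc (Suc k))" using k by simp
    then have "k = 0 \<or> Suc (Suc k) = ?m"
      using inj[of 0 k] inj[of 0 "Suc (Suc k)"] k(1) m by (cases "Suc (Suc k) = ?m") auto
    then show ?thesis
    proof
      assume "Suc (Suc k) = ?m"
      then have "Suc k = ?m - 1" by simp
      then show ?thesis using k(2) by simp
    qed (use k(2) in simp)
  qed
  have "nbrs T ?r = nbrs S ?r - {?a, ?b}"
    using only ab m by (auto simp: nbrs_def T_def)
  then show d1: "deg T ?r = 1" using abr ab us(2) by (simp add: card_Diff_subset)
  have us2: "deg S v = 2" if w: "v \<in> set us" "v \<noteq> ?r" for v
    using cyc_nth_neq_2[OF m(2,1)] by (rule_tac pendant_cycle_nbrs[OF us(1) w]) simp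
  have "(\<Sum>v\<in>S. deg S v - 2) = (\<Sum>v\<in>T. deg S v - 2)"
    using S us2 by (intro sum.mono_neutral_right) (auto simp: T_def)
  also have "\<dots> = (\<Sum>v\<in>T - {?r}. deg S v - 2) + 1"
    using S r us(2) by (subst sum.remove[of T ?r]) (auto simp: T_def)
  also have "(\<Sum>v\<in>T - {?r}. deg S v - 2) = (\<Sum>v\<in>T - {?r}. deg T v - 2)"
    using nbT by simp
  also have "\<dots> = (\<Sum>v\<in>T. deg T v - 2)"
    using S r d1 by (intro sum.mono_neutral_left) (auto simp: T_def)
  finally show "bnd S = Suc (bnd T)" by (simp add: bnd_def)
  show "leaves T = insert ?r (leaves S)"
  proof (intro equalityI subsetI)
    fix v assume "v \<in> leaves T"
    then show "v \<in> insert ?r (leaves S)"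
      using nbT[of v] by (cases "v = ?r") (simp_all add: leaves_def, simp add: T_def)
  next
    fix v assume v: "v \<in> insert ?r (leaves S)"
    show "v \<in> leaves T"
    proof (cases "v = ?r")
      case True
      then show ?thesis using r d1 by (simp add: leaves_def)
    next
      case False
      with v us2[of v] have "v \<in> T" by (auto simp: leaves_def T_def)
      with v False nbT[of v] show ?thesis by (simp add: leaves_def)
    qed
  qed
qed

definition cycle_arcs :: "'a list \<Rightarrow> ('a \<times> 'a) set" where
  "cycle_arcs us = (\<Union>k. {(cyc_nth us k, cyc_nth us (Suc k)), (cyc_nth us (Suc k), cyc_nth us k)})"

lemma cycle_arcs_in_set: "us \<noteq> [] \<Longrightarrow> (u, v) \<in> cycle_arcs us \<Longrightarrow> u \<in> set us \<and> v \<in> set us"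
  by (auto simp: cycle_arcs_def)

text \<open>The attachment vertex may stand anywhere in the list \<open>cy x\<close>. The last
  clause confines adjacencies to the tree and to consecutive vertices of a single cycle.\<close>

definition tree_with_cycles :: "'a set \<Rightarrow> 'a set \<Rightarrow> 'a set \<Rightarrow> ('a \<Rightarrow> 'a list) \<Rightarrow> bool" where
  "tree_with_cycles S T L cy \<longleftrightarrow> linked T \<and> acyclic_on T \<and> L \<subseteq> leaves T \<and>
     (\<forall>x\<in>L. closed_cycle (cy x) \<and> type1 (cy x) \<and> set (cy x) \<inter> T = {x}) \<and>
     (\<forall>x\<in>L. \<forall>y\<in>L. x \<noteq> y \<longrightarrow> set (cy x) \<inter> set (cy y) = {}) \<and>
     S = T \<union> (\<Union>x\<in>L. set (cy x)) \<and>
     (\<forall>u\<in>S. \<forall>v\<in>S. A u v \<noteq> 0 \<longrightarrow> u \<in> T \<and> v \<in> T \<or> (\<exists>x\<in>L. (u, v) \<in> cycle_arcs (cy x)))"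

text \<open>Stripping a pendant cycle lowers nullity and bound by 1 each, so equality persists, and
  \<open>l\<close> remains a leaf from which the search can start again. The two counting clauses
  later determine the number of cycles.\<close>

lemma extremal_decomposition:
  assumes "finite S" "linked S" "l \<in> leaves S" "left_nullity A S S = bnd S"
  shows "\<exists>T L cy. tree_with_cycles S T L cy \<and> left_nullity A T T = bnd T \<and>
    bnd S = bnd T + card L \<and> card (leaves T) = card (leaves S) + card L"
  using assms
proof (induction "card S" arbitrary: S rule: less_induct)
  case less
  show ?case
  proof (cases "acyclic_on S")
    case True
    then have "tree_with_cycles S S {} (\<lambda>_. [])" using less.prems by (simp add: tree_with_cycles_def)
    then show ?thesis using less.prems by (intro exI[of _ S] exI[of _ "{}"] exI[of _ "\<lambda>_. []"]) simp
  next
    case False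
    then obtain us where us: "closed_cycle us" "set us \<subseteq> S" by (auto simp: acyclic_on_def)
    have l: "l \<in> S" "deg S l = 1" using less.prems by (auto simp: leaves_def)
    obtain vs where vs: "pendant_cycle S vs" "type1 vs" "deg S (cyc_nth vs 0) = 3"
      using extremal_pendant_cycle[OF less.prems(1,2) l less.prems(4) us] by metis
    let ?r = "cyc_nth vs 0"
    define S' where "S' = S - (set vs - {?r})"
    note strip = strip_cycle[OF less.prems(1,2) vs(1,3), folded S'_def]
    have cc: "closed_cycle vs" and vsS: "set vs \<subseteq> S" using vs(1) by (auto simp: pendant_cycle_def)
    have ne: "vs \<noteq> []" using cc by (rule closed_cycle_nonempty)
    have fin: "finite S'" using less.prems by (simp add: S'_def)
    have S': "S = S' \<union> set vs" "S' \<inter> set vs = {?r}" using vsS ne by (auto simp: S'_def)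
    have "cyc_nth vs 1 \<in> S - S'"
    proof -
      have "cyc_nth vs 1 \<noteq> ?r"
        using cc ne cyc_nth_eq_iff[of vs 1 0] by (simp add: closed_cycle_def)
      then show ?thesis using ne vsS by (auto simp: S'_def)
    qed
    then have "card S' < card S" using less.prems(1) by (intro psubset_card_mono) (auto simp: S'_def)
    moreover have "l \<in> leaves S'" using strip(5) less.prems(3) by simp
    moreover have null: "left_nullity A S S = Suc (left_nullity A S' S')"
      by (rule left_nullity_type1_cycle[OF less.prems(1) S' vs(1,2)])
    then have "left_nullity A S' S' = bnd S'" using less.prems(4) strip(3) by simp
    ultimately obtain T L cy where IH: "tree_with_cycles S' T L cy" "left_nullity A T T = bnd T"
      "bnd S' = bnd T + card L" "card (leaves T) = card (leaves S') + card L"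
      using less.hyps[of S'] strip(1) fin by blast
    note tw = IH(1)[unfolded tree_with_cycles_def]
    have T: "linked T" using tw by (elim conjE)
    have acyc: "acyclic_on T" using tw by (elim conjE)
    have LT: "L \<subseteq> leaves T" using tw by (elim conjE)
    have "\<forall>x\<in>L. closed_cycle (cy x) \<and> type1 (cy x) \<and> set (cy x) \<inter> T = {x}"
      using tw by (elim conjE)
    then have cy: "\<And>x. x \<in> L \<Longrightarrow> closed_cycle (cy x)" "\<And>x. x \<in> L \<Longrightarrow> type1 (cy x)"
      "\<And>x. x \<in> L \<Longrightarrow> set (cy x) \<inter> T = {x}" by simp_all
    have "\<forall>x\<in>L. \<forall>y\<in>L. x \<noteq> y \<longrightarrow> set (cy x) \<inter> set (cy y) = {}"
      using tw by (elim conjE)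
    note dis = this[rule_format]
    have un: "S' = T \<union> (\<Union>x\<in>L. set (cy x))" using tw by (elim conjE)
    have "\<forall>u\<in>S'. \<forall>v\<in>S'. A u v \<noteq> 0 \<longrightarrow> u \<in> T \<and> v \<in> T \<or> (\<exists>x\<in>L. (u, v) \<in> cycle_arcs (cy x))"
      using tw by (elim conjE)
    note arcs = this[rule_format]
    have r_cy: "?r \<notin> set (cy x)" if x: "x \<in> L" for x
    proof
      assume "?r \<in> set (cy x)"
      then have "deg S' ?r \<ge> 2" using cycle_deg_ge_2[OF fin cy(1)[OF x]] un x by blast
      then show False using strip(2) by simp
    qed
    have rT: "?r \<in> T" using r_cy S'(2) un by blast
    have rL: "?r \<notin> L" using r_cy cy(3) by blast
    have "nbrs T ?r = nbrs S' ?r"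
    proof
      show "nbrs T ?r \<subseteq> nbrs S' ?r" using un by (auto simp: nbrs_def)
      show "nbrs S' ?r \<subseteq> nbrs T ?r"
      proof
        fix v assume v: "v \<in> nbrs S' ?r"
        have "v \<in> T"
        proof (rule ccontr)
          assume "v \<notin> T"
          then obtain x where x: "x \<in> L" "(?r, v) \<in> cycle_arcs (cy x)"
            using arcs[of ?r v] v S'(2) by (auto simp: nbrs_def)
          then show False using r_cy cycle_arcs_in_set[OF closed_cycle_nonempty[OF cy(1)]] by blast
        qed
        then show "v \<in> nbrs T ?r" using v by (simp add: nbrs_def)
      qed
    qed
    then have r_leaf: "?r \<in> leaves T" using rT strip(2) by (simp add: leaves_def)
    define cy' where "cy' = cy(?r := vs)"
    have cy': "cy' ?r = vs" "\<And>x. x \<in> L \<Longrightarrow> cy' x = cy x" using rL by (auto simp: cy'_def)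
    have TS': "T \<subseteq> S'" and cyS': "\<And>x. x \<in> L \<Longrightarrow> set (cy x) \<subseteq> S'" using un by auto
    have "tree_with_cycles S T (insert ?r L) cy'"
      unfolding tree_with_cycles_def
    proof (intro conjI)
      show "insert ?r L \<subseteq> leaves T" using LT r_leaf by simp
      show "\<forall>x\<in>insert ?r L. closed_cycle (cy' x) \<and> type1 (cy' x) \<and> set (cy' x) \<inter> T = {x}"
        using cy cc vs(2) cy' rT TS' S'(2) by auto
      have "set vs \<inter> set (cy x) = {}" if x: "x \<in> L" for x
      proof (rule equals0I)
        fix v assume v: "v \<in> set vs \<inter> set (cy x)"
        then have "v \<in> S' \<inter> set vs" using cyS'[OF x] by blast
        then have "v = ?r" using S'(2) by simp
        then show False using v r_cy[OF x] by simp
      qed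
      then show "\<forall>x\<in>insert ?r L. \<forall>y\<in>insert ?r L. x \<noteq> y \<longrightarrow> set (cy' x) \<inter> set (cy' y) = {}"
        using dis cy' by (auto simp: Int_commute)
      show "S = T \<union> (\<Union>x\<in>insert ?r L. set (cy' x))" using S'(1) un cy' by auto
      have vs_arc: "(u, v) \<in> cycle_arcs vs \<and> (v, u) \<in> cycle_arcs vs"
        if u: "u \<in> set vs" "u \<noteq> ?r" and v: "v \<in> nbrs S u" for u v
      proof (rule pendant_cycle_nbrs[OF vs(1) u])
        fix k assume "u = cyc_nth vs (Suc k)" "nbrs S u = {cyc_nth vs k, cyc_nth vs (Suc (Suc k))}"
        then show ?thesis using v by (auto simp: cycle_arcs_def)
      qed
      show "\<forall>u\<in>S. \<forall>v\<in>S. A u v \<noteq> 0 \<longrightarrow> u \<in> T \<and> v \<in> T \<or> (\<exists>x\<in>insert ?r L. (u, v) \<in> cycle_arcs (cy' x))"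
      proof (intro ballI impI)
        fix u v assume uv: "u \<in> S" "v \<in> S" "A u v \<noteq> 0"
        consider "u \<in> S'" "v \<in> S'" | "u \<in> set vs" "u \<noteq> ?r" | "v \<in> set vs" "v \<noteq> ?r"
          using uv by (auto simp: S'_def)
        then show "u \<in> T \<and> v \<in> T \<or> (\<exists>x\<in>insert ?r L. (u, v) \<in> cycle_arcs (cy' x))"
        proof cases
          case 1
          then show ?thesis using arcs[OF 1 uv(3)] cy'(2) by auto
        next
          case 2
          then show ?thesis using vs_arc[of u v] uv cy'(1) by (auto simp: nbrs_def)
        next
          case 3
          then show ?thesis using vs_arc[of v u] uv cy'(1) adj_sym[of u v] by (auto simp: nbrs_def)
        qed
      qed
    qed (use T acyc in auto)
    moreover have finL: "finite L" using LT fin TS' by (auto simp: leaves_def intro: finite_subset)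
    then have cL: "card (insert ?r L) = Suc (card L)" using rL by simp
    then have "bnd S = bnd T + card (insert ?r L)" using strip(3) IH(3) by simp
    moreover have "?r \<notin> leaves S" using vs(3) by (simp add: leaves_def)
    then have "card (leaves S') = Suc (card (leaves S))"
      using strip(5) less.prems(1) by (simp add: leaves_def)
    then have "card (leaves T) = card (leaves S) + card (insert ?r L)" using IH(4) cL by simp
    ultimately show ?thesis using IH(2) by blast
  qed
qed

end

section \<open>Invariance under rotation, and the attachment of several cycles\<close>

lemma cyc_nth_Suc_eq_iff:
  assumes "distinct us" "us \<noteq> []"
  shows "cyc_nth us (Suc i) = cyc_nth us (Suc k) \<longleftrightarrow> cyc_nth us i = cyc_nth us k"
proof
  let ?m = "length us"
  have shift: "(Suc n + (?m - 1)) mod ?m = n mod ?m" for n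
  proof -
    have "Suc n + (?m - 1) = n + ?m" using assms(2) by (cases us) simp_all
    then show ?thesis by (simp only: mod_add_self2)
  qed
  assume "cyc_nth us (Suc i) = cyc_nth us (Suc k)"
  then have "Suc i mod ?m = Suc k mod ?m" using assms by (simp add: cyc_nth_eq_iff)
  then have "(Suc i + (?m - 1)) mod ?m = (Suc k + (?m - 1)) mod ?m" by (rule mod_add_cong) simp
  then show "cyc_nth us i = cyc_nth us k" unfolding shift using assms by (simp add: cyc_nth_eq_iff)
next
  assume "cyc_nth us i = cyc_nth us k"
  then have "i mod length us = k mod length us" using assms by (simp add: cyc_nth_eq_iff)
  then show "cyc_nth us (Suc i) = cyc_nth us (Suc k)" by (metis cyc_nth_def mod_Suc_eq)
qed

lemma cyc_nth_mod: "cyc_nth us (k mod length us) = cyc_nth us k"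
  by (simp add: cyc_nth_def)

lemma cyc_nth_Suc_mod: "cyc_nth us (Suc (k mod length us)) = cyc_nth us (Suc k)"
  by (simp add: cyc_nth_def mod_Suc_eq)

context gain_matrix
begin

lemma path_gain_rotate:
  assumes "closed_cycle us"
  shows "path_gain (rotate n us) k = inverse (path_gain us n) * path_gain us (n + k)"
proof (induction k)
  case 0
  then show ?case using path_gain_nonzero[OF assms] by simp
next
  case (Suc k)
  then show ?case using closed_cycle_nonempty[OF assms]
    by (simp add: path_gain_Suc cyc_nth_rotate mult.assoc)
qed

lemma path_gain_add_length:
  "path_gain us (n + length us) = path_gain us (length us) * path_gain us n"
proof (induction n)
  case (Suc n)
  then show ?case
    using cyc_nth_add_length[of us n] cyc_nth_add_length[of us "Suc n"]
    by (simp add: path_gain_Suc mult.assoc)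
qed simp

text \<open>Rotation conjugates the cycle gain by the gain of the first \<open>n\<close> steps; this
  fixes 1 and -1, which commute with everything.\<close>

lemma type1_rotate:
  assumes "closed_cycle us" "type1 us"
  shows "type1 (rotate n us)"
proof -
  let ?s = "(- 1) ^ (length us div 2) :: 'k"
  have "path_gain us n \<noteq> 0" using assms(1) by (rule path_gain_nonzero)
  moreover have "?s = 1 \<or> ?s = - 1" by (cases "even (length us div 2)") auto
  ultimately have "inverse (path_gain us n) * (?s * path_gain us n) = ?s" by auto
  then show ?thesis
    using assms by (simp add: type1_def path_gain_rotate path_gain_add_length)
qed

lemma cycle_arcs_rotate:
  assumes "us \<noteq> []"
  shows "cycle_arcs (rotate n us) = cycle_arcs us"
proof
  show "cycle_arcs (rotate n us) \<subseteq> cycle_arcs us"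
    using assms by (auto simp: cycle_arcs_def cyc_nth_rotate)
  \<comment> \<open>Going on by \<open>(length us - 1) * n\<close> positions after the first
    \<open>n\<close> completes \<open>n\<close> full turns.\<close>
  have per: "cyc_nth us (n + (k + (length us - 1) * n)) = cyc_nth us k" for k
  proof -
    have "n + (k + (length us - 1) * n) = k + n * length us"
      using assms by (cases us) (auto simp: algebra_simps)
    then show ?thesis by (simp only: cyc_nth_def mod_mult_self1)
  qed
  show "cycle_arcs us \<subseteq> cycle_arcs (rotate n us)"
  proof -
    have "(cyc_nth us k, cyc_nth us (Suc k)) \<in> cycle_arcs (rotate n us)
        \<and> (cyc_nth us (Suc k), cyc_nth us k) \<in> cycle_arcs (rotate n us)" for k
      using per[of k] per[of "Suc k"] assms unfolding cycle_arcs_def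
      by (auto simp: cyc_nth_rotate intro!: exI[of _ "k + (length us - 1) * n"])
    then show ?thesis by (auto simp: cycle_arcs_def)
  qed
qed

lemma cycle_arcs_Suc_iff:
  assumes "distinct us" "us \<noteq> []"
  shows "(cyc_nth us (Suc k), v) \<in> cycle_arcs us \<longleftrightarrow> v = cyc_nth us k \<or> v = cyc_nth us (Suc (Suc k))"
proof -
  have "v = cyc_nth us k \<or> v = cyc_nth us (Suc (Suc k))"
    if "(cyc_nth us (Suc k), v) \<in> cycle_arcs us"
  proof -
    obtain i where "cyc_nth us (Suc k) = cyc_nth us i \<and> v = cyc_nth us (Suc i) \<or>
      cyc_nth us (Suc k) = cyc_nth us (Suc i) \<and> v = cyc_nth us i"
      using \<open>(cyc_nth us (Suc k), v) \<in> cycle_arcs us\<close> by (auto simp: cycle_arcs_def)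
    then show ?thesis
      using cyc_nth_Suc_eq_iff[OF assms, of "Suc k" i] cyc_nth_Suc_eq_iff[OF assms, of k i] by auto
  qed
  then show ?thesis by (auto simp: cycle_arcs_def)
qed

lemma cycle_arcs_conv:
  assumes "us \<noteq> []"
  shows "cycle_arcs us = (\<Union>i<length us. {(us ! i, us ! (Suc i mod length us)), (us ! (Suc i mod length us), us ! i)})"
proof -
  have "cycle_arcs us = (\<Union>k\<in>{..<length us}. {(cyc_nth us k, cyc_nth us (Suc k)), (cyc_nth us (Suc k), cyc_nth us k)})"
    (is "_ = \<Union>(?f ` _)")
  proof -
    have "?f k = ?f (k mod length us)" for k by (simp only: cyc_nth_mod cyc_nth_Suc_mod)
    moreover have "k mod length us \<in> {..<length us}" for k using assms by simp
    ultimately have "(\<Union>k. ?f k) = \<Union>(?f ` {..<length us})" by blast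
    then show ?thesis by (simp add: cycle_arcs_def)
  qed
  also have "\<dots> = (\<Union>i<length us. {(us ! i, us ! (Suc i mod length us)), (us ! (Suc i mod length us), us ! i)})"
    by (intro SUP_cong) (auto simp: cyc_nth_def)
  finally show ?thesis .
qed

text \<open>The cycles are added one at a time: \<open>S0\<close> with the cycles attached so far is
  the \<open>T\<close> of \<open>left_nullity_type1_cycle\<close>. The assumption on arcs makes the
  new cycle pendant.\<close>

lemma left_nullity_attach:
  assumes "finite S0" "finite F"
    and "\<And>x. x \<in> F \<Longrightarrow> closed_cycle (cy x) \<and> type1 (cy x) \<and> set (cy x) \<inter> S0 = {x}"
    and "\<And>x y. x \<in> F \<Longrightarrow> y \<in> F \<Longrightarrow> x \<noteq> y \<Longrightarrow> set (cy x) \<inter> set (cy y) = {}"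
    and "\<And>u v. u \<in> S0 \<union> (\<Union>x\<in>F. set (cy x)) \<Longrightarrow> v \<in> S0 \<union> (\<Union>x\<in>F. set (cy x)) \<Longrightarrow> A u v \<noteq> 0 \<Longrightarrow>
      u \<in> S0 \<and> v \<in> S0 \<or> (\<exists>x\<in>F. (u, v) \<in> cycle_arcs (cy x))"
  defines "S \<equiv> S0 \<union> (\<Union>x\<in>F. set (cy x))"
  shows "left_nullity A S S = left_nullity A S0 S0 + card F"
  unfolding S_def using assms(2-5)
proof (induction F rule: finite_induct)
  case (insert x F)
  let ?S = "\<lambda>F. S0 \<union> (\<Union>x\<in>F. set (cy x))"
  have x: "closed_cycle (cy x)" "type1 (cy x)" "set (cy x) \<inter> S0 = {x}" using insert.prems(1) by auto
  have ne: "cy x \<noteq> []" using x(1) by (rule closed_cycle_nonempty)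
  have disj: "set (cy x) \<inter> set (cy y) = {}" if "y \<in> F" for y
    using insert.prems(2)[of x y] insert.hyps that by auto
  have mem: "v \<in> set (cy y)" if "(u, v) \<in> cycle_arcs (cy y) \<or> (v, u) \<in> cycle_arcs (cy y)" "y \<in> insert x F" for u v y
    using that insert.prems(1)[OF that(2)] cycle_arcs_in_set[OF closed_cycle_nonempty] by blast
  have "left_nullity A (?S F) (?S F) = left_nullity A S0 S0 + card F"
  proof (rule insert.IH)
    fix u v assume uv: "u \<in> ?S F" "v \<in> ?S F" "A u v \<noteq> 0"
    then have "u \<in> S0 \<and> v \<in> S0 \<or> (\<exists>y\<in>insert x F. (u, v) \<in> cycle_arcs (cy y))"
      by (intro insert.prems(3)) auto
    then show "u \<in> S0 \<and> v \<in> S0 \<or> (\<exists>y\<in>F. (u, v) \<in> cycle_arcs (cy y))"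
    proof
      assume "\<exists>y\<in>insert x F. (u, v) \<in> cycle_arcs (cy y)"
      then obtain y where y: "y \<in> insert x F" "(u, v) \<in> cycle_arcs (cy y)" by blast
      show ?thesis
      proof (cases "y = x")
        case True
        then have "u \<in> set (cy x)" "v \<in> set (cy x)" using mem[of u v x] mem[of v u x] y by auto
        then have "u \<in> S0" "v \<in> S0" using uv disj by blast+
        then show ?thesis by blast
      qed (use y in blast)
    qed simp
  qed (use insert.prems in auto)
  moreover have "left_nullity A (?S (insert x F)) (?S (insert x F)) = Suc (left_nullity A (?S F) (?S F))"
  proof -
    \<comment> \<open>The cycle is rotated to start at \<open>x\<close>, as the root of a pendant
      cycle has position 0.\<close>
    obtain n where n: "x = cyc_nth (cy x) (Suc n)"
      using x(3) in_set_cyc_nth_Suc[of x "cy x"] by blast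
    define us where "us = rotate (Suc n) (cy x)"
    have us: "closed_cycle us" "type1 us" "set us = set (cy x)" "cyc_nth us 0 = x"
      "cycle_arcs us = cycle_arcs (cy x)"
      using closed_cycle_rotate[OF x(1), of "Suc n"] type1_rotate[OF x(1,2), of "Suc n"]
        cycle_arcs_rotate[OF ne, of "Suc n"]
        cyc_nth_rotate[OF ne, of "Suc n" 0] n unfolding us_def by auto
    have une: "us \<noteq> []" "distinct us" using us(1) by (auto simp: closed_cycle_def)
    have S: "?S (insert x F) = ?S F \<union> set us" using us(3) by auto
    have int: "?S F \<inter> set us = {cyc_nth us 0}"
      using us(3,4) x(3) disj by auto
    have pend: "pendant_cycle (?S (insert x F)) us"
      unfolding pendant_cycle_def
    proof (intro conjI allI impI)
      fix k assume k: "Suc k < length us"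
      let ?w = "cyc_nth us (Suc k)"
      have w: "?w \<in> set (cy x)" using us(3) une(1) cyc_nth_in_set by metis
      have wx: "?w \<noteq> x" using us(4) cyc_nth_eq_iff[OF une(2,1), of "Suc k" 0] k by auto
      have wS: "?w \<notin> S0" using w wx x(3) by blast
      have "v = cyc_nth us k \<or> v = cyc_nth us (Suc (Suc k))" if v: "v \<in> nbrs (?S (insert x F)) ?w" for v
      proof -
        have "?w \<in> S0 \<and> v \<in> S0 \<or> (\<exists>y\<in>insert x F. (?w, v) \<in> cycle_arcs (cy y))"
          using v w by (intro insert.prems(3)) (auto simp: nbrs_def)
        then obtain y where y: "y \<in> insert x F" "(?w, v) \<in> cycle_arcs (cy y)" using wS by blast
        have "?w \<in> set (cy y)" using mem[of v ?w y] y by blast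
        then have "y = x" using y(1) w disj by blast
        then have "(?w, v) \<in> cycle_arcs us" using y(2) us(5) by simp
        then show ?thesis using cycle_arcs_Suc_iff[OF une(2,1)] by simp
      qed
      moreover have "{cyc_nth us k, cyc_nth us (Suc (Suc k))} \<subseteq> nbrs (?S (insert x F)) ?w"
        using us by (intro cycle_nbrs) auto
      ultimately show "nbrs (?S (insert x F)) ?w = {cyc_nth us k, cyc_nth us (Suc (Suc k))}" by blast
    qed (use us in auto)
    have "finite (?S (insert x F))" using assms(1) insert.hyps by auto
    from left_nullity_type1_cycle[OF this S int pend us(2)] show ?thesis .
  qed
  ultimately show ?case using insert.hyps by simp
qed simp

end

section \<open>Gain graphs and their adjacency matrices\<close>

lemma parcs_symD: "pair_graph H \<Longrightarrow> (u, v) \<in> parcs H \<Longrightarrow> (v, u) \<in> parcs H"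
  using pair_sym_digraph.pair_sym_arcs[of H]
  by (auto simp: pair_graph_def pair_pseudo_graph_def symmetric_def sym_def)

lemma parcs_irrefl: "pair_graph H \<Longrightarrow> (u, u) \<notin> parcs H"
  using pair_loopfree_digraph.pair_no_loops[of H "(u, u)"]
  by (auto simp: pair_graph_def pair_digraph_def)

lemma parcs_in_pverts: "pair_graph H \<Longrightarrow> (u, v) \<in> parcs H \<Longrightarrow> u \<in> pverts H \<and> v \<in> pverts H"
  using pair_wf_digraph.in_arcsD1[of H u v] pair_wf_digraph.in_arcsD2[of H u v]
  by (auto simp: pair_graph_def pair_digraph_def pair_fin_digraph_def)

lemma pair_graph_finite: "pair_graph H \<Longrightarrow> finite (pverts H)" "pair_graph H \<Longrightarrow> finite (parcs H)"
  using pair_fin_digraph.pair_finite_verts[of H] pair_fin_digraph.pair_finite_arcs[of H]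
  by (auto simp: pair_graph_def pair_digraph_def)

lemma pair_graphI:
  assumes "finite (pverts H)" "\<And>u v. (u, v) \<in> parcs H \<Longrightarrow> u \<in> pverts H \<and> v \<in> pverts H"
    "\<And>u v. (u, v) \<in> parcs H \<Longrightarrow> (v, u) \<in> parcs H" "\<And>u. (u, u) \<notin> parcs H"
  shows "pair_graph H"
proof
  have "parcs H \<subseteq> pverts H \<times> pverts H" using assms(2) by auto
  then show "finite (parcs H)" using assms(1) by (meson finite_SigmaI finite_subset)
  show "symmetric (with_proj H)" using assms(3) by (auto simp: symmetric_def sym_def)
  fix e assume e: "e \<in> parcs H"
  show "fst e \<in> pverts H" "snd e \<in> pverts H" using assms(2)[of "fst e" "snd e"] e by simp_all
  show "fst e \<noteq> snd e"
  proof
    assume "fst e = snd e"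
    then have "e = (fst e, fst e)" by (simp add: prod_eq_iff)
    then show False using e assms(4) by metis
  qed
qed (rule assms)

lemma out_degree_eq_card: "out_degree (with_proj H) v = card {u. (v, u) \<in> parcs H}"
proof -
  have "out_arcs (with_proj H) v = Pair v ` {u. (v, u) \<in> parcs H}" by (auto simp: out_arcs_def)
  then show ?thesis by (simp add: out_degree_def card_image inj_on_def)
qed

text \<open>\<open>connected\<close> is strong connectivity of the symmetric closure, here the arc
  set itself. The set reached from a vertex has no leaving arc, so under the cut condition it is
  everything.\<close>

lemma connected_cut:
  assumes "pair_graph H"
  shows "Digraph_Component.connected (with_proj H) \<longleftrightarrow> pverts H \<noteq> {} \<and>
    (\<forall>Q. Q \<noteq> {} \<longrightarrow> Q \<subset> pverts H \<longrightarrow> (\<exists>u\<in>Q. \<exists>v\<in>pverts H - Q. (u, v) \<in> parcs H))"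
proof -
  let ?V = "pverts H" and ?E = "parcs H"
  have symE: "(?E)\<^sup>s = ?E" using parcs_symD[OF assms] by (auto simp: symcl_def)
  have "(\<forall>u\<in>?V. \<forall>v\<in>?V. (u, v) \<in> rtrancl_on ?V ?E) \<longleftrightarrow>
    (\<forall>Q. Q \<noteq> {} \<longrightarrow> Q \<subset> ?V \<longrightarrow> (\<exists>u\<in>Q. \<exists>v\<in>?V - Q. (u, v) \<in> ?E))" (is "?L \<longleftrightarrow> ?R")
  proof
    assume L: ?L
    show ?R
    proof (intro allI impI, rule ccontr)
      fix Q assume Q: "Q \<noteq> {}" "Q \<subset> ?V" and no: "\<not> (\<exists>u\<in>Q. \<exists>v\<in>?V - Q. (u, v) \<in> ?E)"
      obtain u v where uv: "u \<in> Q" "v \<in> ?V - Q" using Q by blast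
      then have "(u, v) \<in> rtrancl_on ?V ?E" using L Q by blast
      then have "v \<in> Q" by (induction rule: rtrancl_on_induct) (use uv no in auto)
      then show False using uv by simp
    qed
  next
    assume R: ?R
    show ?L
    proof (intro ballI)
      fix u v assume u: "u \<in> ?V" and v: "v \<in> ?V"
      define Q where "Q = {w. (u, w) \<in> rtrancl_on ?V ?E}"
      have QV: "Q \<subseteq> ?V" using in_rtrancl_on_in_F by (auto simp: Q_def)
      have Q0: "Q \<noteq> {}" using u by (auto simp: Q_def)
      have "Q = ?V"
      proof (rule ccontr)
        assume "Q \<noteq> ?V"
        then have "Q \<subset> ?V" using QV by blast
        with R Q0 have "\<exists>a\<in>Q. \<exists>b\<in>?V - Q. (a, b) \<in> ?E" by simp
        then obtain a b where ab: "a \<in> Q" "b \<in> ?V - Q" "(a, b) \<in> ?E" by blast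
        then have "b \<in> Q" unfolding Q_def using rtrancl_on_into_rtrancl_on[of u a ?V ?E b] by simp
        then show False using ab by simp
      qed
      then show "(u, v) \<in> rtrancl_on ?V ?E" using v by (auto simp: Q_def)
    qed
  qed
  then show ?thesis by (simp add: connected_conv symE)
qed

lemma card_sccs_connected:
  assumes "pair_graph H" "Digraph_Component.connected (with_proj H)"
  shows "card (pre_digraph.sccs (with_proj H)) = 1"
proof -
  interpret pair_graph H by fact
  have symE: "(parcs H)\<^sup>s = parcs H" using parcs_symD[OF assms(1)] by (auto simp: symcl_def)
  have V: "pverts H \<noteq> {}" and R: "\<And>u v. u \<in> pverts H \<Longrightarrow> v \<in> pverts H \<Longrightarrow> u \<rightarrow>\<^sup>*\<^bsub>with_proj H\<^esub> v"
    using assms(2) by (auto simp: connected_conv symE reachable_def)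
  have reach_in: "v \<in> pverts H" if "u \<rightarrow>\<^sup>*\<^bsub>with_proj H\<^esub> v" for u v
    using in_rtrancl_on_in_F(2)[OF that[unfolded reachable_def]] by simp
  have "sccs_verts = {pverts H}"
  proof
    show "sccs_verts \<subseteq> {pverts H}"
    proof
      fix S assume S: "S \<in> sccs_verts"
      then obtain u where u: "u \<in> S" by (auto simp: in_sccs_verts_conv_reachable)
      have SV: "S \<subseteq> pverts H"
        using S reach_in by (auto simp: in_sccs_verts_conv_reachable)
      have "pverts H \<subseteq> S"
      proof
        fix v assume v: "v \<in> pverts H"
        have uV: "u \<in> pverts H" using u SV by blast
        show "v \<in> S"
        proof (rule ccontr)
          assume "v \<notin> S"
          then show False using S u R[OF uV v] R[OF v uV] unfolding in_sccs_verts_conv_reachable by blast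
        qed
      qed
      then show "S \<in> {pverts H}" using SV by simp
    qed
    have "pverts H \<in> sccs_verts"
      unfolding in_sccs_verts_conv_reachable by (intro conjI ballI allI impI V) (use R reach_in in blast)+
    then show "{pverts H} \<subseteq> sccs_verts" by simp
  qed
  then show ?thesis using card_sccs_verts by simp
qed

lemma card_parcs_eq_edges:
  assumes "pair_graph H"
  shows "card (parcs H) = 2 * card (edges H)"
proof -
  let ?f = "\<lambda>(u, v). {u, v}"
  have fin: "finite (parcs H)" by (rule pair_graph_finite(2)[OF assms])
  have "card {a \<in> parcs H. ?f a = e} = 2" if "e \<in> edges H" for e
  proof -
    obtain u v where uv: "(u, v) \<in> parcs H" "e = {u, v}" using \<open>e \<in> edges H\<close> by (auto simp: edges_def)
    then have "u \<noteq> v" "(v, u) \<in> parcs H" using parcs_irrefl[OF assms] parcs_symD[OF assms] by auto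
    then have "{a \<in> parcs H. ?f a = e} = {(u, v), (v, u)}" using uv by (auto simp: doubleton_eq_iff)
    then show ?thesis using \<open>u \<noteq> v\<close> by simp
  qed
  then have "(\<Sum>e\<in>edges H. card {a \<in> parcs H. ?f a = e}) = 2 * card (edges H)" by simp
  moreover have "card (parcs H) = (\<Sum>e\<in>edges H. card {a \<in> parcs H. ?f a = e})"
    using sum.image_gen[OF fin, of "\<lambda>_. 1::nat" ?f] by (simp add: edges_def)
  ultimately show ?thesis by simp
qed

lemma card_parcs_eq_degree_sum:
  assumes "pair_graph H"
  shows "card (parcs H) = (\<Sum>v\<in>pverts H. card {u. (v, u) \<in> parcs H})"
proof -
  have "parcs H = (SIGMA v:pverts H. {u. (v, u) \<in> parcs H})" using parcs_in_pverts[OF assms] by auto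
  moreover have "finite {u. (v, u) \<in> parcs H}" for v
    using pair_graph_finite(1)[OF assms] parcs_in_pverts[OF assms] by (auto intro: finite_subset)
  ultimately show ?thesis
    using card_SigmaI[of "pverts H" "\<lambda>v. {u. (v, u) \<in> parcs H}"] pair_graph_finite(1)[OF assms] by simp
qed

section \<open>Graph notions expressed through the adjacency matrix\<close>

lemma qnorm_0 [simp]: "qnorm 0 = 0"
  by (simp add: qnorm_def zero_quat_def)

lemma adjacency_nonzero_iff:
  assumes "uq_gain_graph G"
  shows "adjacency G u v \<noteq> 0 \<longleftrightarrow> (u, v) \<in> garcs G"
  using assms by (auto simp: adjacency_def uq_gain_graph_def)

lemma gain_matrix_adjacency:
  assumes "uq_gain_graph G"
  shows "gain_matrix (adjacency G)"
proof
  have pg: "pair_graph (ugraph G)" using assms by (simp add: uq_gain_graph_def)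
  show "adjacency G i i = 0" for i using parcs_irrefl[OF pg] by (simp add: adjacency_def)
  show "adjacency G j i = inverse (adjacency G i j)" for i j
    using parcs_symD[OF pg, of i j] parcs_symD[OF pg, of j i] assms
    by (auto simp: adjacency_def uq_gain_graph_def)
qed

lemma uq_gain_subgraph:
  assumes "uq_gain_graph G" "W \<subseteq> gverts G" "E \<subseteq> garcs G" "sym E" "E \<subseteq> W \<times> W"
  shows "uq_gain_graph \<lparr>ugraph = \<lparr>pverts = W, parcs = E\<rparr>, gain = gain G\<rparr>"
proof -
  have pg: "pair_graph (ugraph G)" using assms(1) by (simp add: uq_gain_graph_def)
  have "pair_graph \<lparr>pverts = W, parcs = E\<rparr>"
    using assms parcs_irrefl[OF pg] pair_graph_finite(1)[OF pg]
    by (intro pair_graphI) (auto intro: finite_subset dest: symD)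
  then show ?thesis using assms by (auto simp: uq_gain_graph_def)
qed

text \<open>The matrix may belong to a larger graph: agreement with \<open>H\<close> is asked only
  on the vertices of \<open>H\<close>. Thus the matrix of \<open>G\<close> also serves for the tree
  inside \<open>G\<close>.\<close>

lemma (in gain_matrix) nbrs_eq_out:
  assumes "pair_graph H" "\<And>u v. u \<in> pverts H \<Longrightarrow> v \<in> pverts H \<Longrightarrow> A u v \<noteq> 0 \<longleftrightarrow> (u, v) \<in> parcs H"
    "v \<in> pverts H"
  shows "nbrs (pverts H) v = {u. (v, u) \<in> parcs H}"
  using assms parcs_in_pverts[OF assms(1)] by (auto simp: nbrs_def)

lemma (in gain_matrix) pendants_eq_leaves:
  assumes "pair_graph H" "\<And>u v. u \<in> pverts H \<Longrightarrow> v \<in> pverts H \<Longrightarrow> A u v \<noteq> 0 \<longleftrightarrow> (u, v) \<in> parcs H"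
  shows "pendants H = leaves (pverts H)"
  using nbrs_eq_out[OF assms] by (auto simp: pendants_def leaves_def out_degree_eq_card)

lemma (in gain_matrix) connected_iff_linked:
  assumes "pair_graph H" "\<And>u v. u \<in> pverts H \<Longrightarrow> v \<in> pverts H \<Longrightarrow> A u v \<noteq> 0 \<longleftrightarrow> (u, v) \<in> parcs H"
  shows "Digraph_Component.connected (with_proj H) \<longleftrightarrow> linked (pverts H)"
proof -
  have "(\<exists>u\<in>Q. \<exists>v\<in>pverts H - Q. (u, v) \<in> parcs H) \<longleftrightarrow> (\<exists>u\<in>Q. \<exists>v\<in>pverts H - Q. A u v \<noteq> 0)"
    if "Q \<subset> pverts H" for Q
    using that assms(2) by (intro bex_cong refl) auto
  then show ?thesis unfolding connected_cut[OF assms(1)] linked_def by auto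
qed

text \<open>The degree sum is 2|E| and there is one component, so 1 + 2|E| - 2|V| + p = 2(|E| - |V|
  + 1) + p - 1.\<close>

lemma (in gain_matrix) bnd_eq_cyclomatic:
  assumes "pair_graph H" "\<And>u v. u \<in> pverts H \<Longrightarrow> v \<in> pverts H \<Longrightarrow> A u v \<noteq> 0 \<longleftrightarrow> (u, v) \<in> parcs H"
    and "linked (pverts H)" "card (pverts H) \<ge> 2"
  shows "int (bnd (pverts H)) = 2 * cyclomatic H + int (card (pendants H)) - 1"
proof -
  have "bnd (pverts H) + 2 * card (pverts H) =
      1 + (\<Sum>v\<in>pverts H. deg (pverts H) v) + card (leaves (pverts H))"
    by (rule bnd_degree_sum[OF pair_graph_finite(1)[OF assms(1)] assms(3,4)])
  moreover have "(\<Sum>v\<in>pverts H. deg (pverts H) v) = 2 * card (edges H)"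
    using card_parcs_eq_degree_sum[OF assms(1)] card_parcs_eq_edges[OF assms(1)] nbrs_eq_out[OF assms(1,2)]
    by simp
  moreover have "card (pre_digraph.sccs (with_proj H)) = 1"
    using card_sccs_connected[OF assms(1)] connected_iff_linked[OF assms(1,2)] assms(3) by simp
  moreover have "pendants H = leaves (pverts H)" using assms(1,2) by (rule pendants_eq_leaves)
  ultimately show ?thesis unfolding cyclomatic_def by simp
qed

lemma (in gain_matrix) cycle_order_closed_cycle:
  assumes "cycle_order C us" "\<And>u v. (u, v) \<in> parcs C \<Longrightarrow> A u v \<noteq> 0"
  shows "closed_cycle us" "pverts C = set us" "parcs C = cycle_arcs us"
proof -
  have us: "length us \<ge> 3" "distinct us" "pverts C = set us" "us \<noteq> []"
    using assms(1) by (auto simp: cycle_order_def)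
  show "pverts C = set us" by fact
  show "parcs C = cycle_arcs us"
    using assms(1) by (simp add: cycle_order_def cycle_arcs_conv[OF us(4)])
  show "closed_cycle us"
  proof (rule closed_cycleI[OF us(1,2)])
    fix i assume "i < length us"
    then have "(us ! i, us ! (Suc i mod length us)) \<in> parcs C" using assms(1) by (auto simp: cycle_order_def)
    then show "A (us ! i) (us ! (Suc i mod length us)) \<noteq> 0" by (rule assms(2))
  qed
qed

lemma (in gain_matrix) closed_cycle_cycle_order:
  assumes "closed_cycle us"
  shows "cycle_order \<lparr>pverts = set us, parcs = cycle_arcs us\<rparr> us"
  using assms closed_cycle_nonempty[OF assms]
  by (simp add: closed_cycle_def cycle_order_def cycle_arcs_conv)

lemma (in gain_matrix) acyclic_on_imp_tree_graph:
  assumes "pair_graph H" "\<And>u v. u \<in> pverts H \<Longrightarrow> v \<in> pverts H \<Longrightarrow> A u v \<noteq> 0 \<longleftrightarrow> (u, v) \<in> parcs H"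
    and "acyclic_on (pverts H)" "linked (pverts H)"
  shows "tree_graph H"
  unfolding tree_graph_def
proof (intro conjI notI)
  show "Digraph_Component.connected (with_proj H)"
    using connected_iff_linked[OF assms(1,2)] assms(4) by simp
  assume "\<exists>C us. cycle_order C us \<and> subgraph (with_proj C) (with_proj H)"
  then obtain C us where C: "cycle_order C us" "pverts C \<subseteq> pverts H" "parcs C \<subseteq> parcs H"
    by (auto simp: subgraph_def)
  have "closed_cycle us" "pverts C = set us"
    using cycle_order_closed_cycle[OF C(1)] C(3) assms(2) parcs_in_pverts[OF assms(1)] by blast+
  then show False using assms(3) C(2) by (auto simp: acyclic_on_def)
qed (rule assms)

lemma (in gain_matrix) path_gain_length:
  assumes "us \<noteq> []"
  shows "path_gain us (length us) =
    prod_list (map (\<lambda>i. A (us ! i) (us ! (Suc i mod length us))) [0..<length us])"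
  unfolding path_gain_def
  by (intro arg_cong[of _ _ prod_list] map_cong) (auto simp: cyc_nth_def)

theorem theorem6p1:
  fixes G :: "'a gain_graph" and n :: nat
  assumes "uq_gain_graph G"
    and "gconnected G"
    and "gorder G = n"
    and "gcyclomatic G \<ge> 1"
    and "gpendant G \<ge> 1"
  shows "int (grank G) = int n - 2 * gcyclomatic G - int (gpendant G) + 1 \<longleftrightarrow>
    (\<exists>(T :: 'a gain_graph) (L :: 'a set) (C :: 'a \<Rightarrow> 'a gain_graph).
       gain_tree T \<and>
       int (gpendant T) > gcyclomatic G \<and>
       int (grank T) = int (gorder T) - int (gpendant T) + 1 \<and>
       int (card L) = gcyclomatic G \<and>
       (\<forall>x\<in>L. type1_cycle (C x)) \<and>
       attached_cycles G T L C)"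
proof -
  let ?A = "adjacency G" and ?V = "gverts G"
  interpret gain_matrix ?A by (rule gain_matrix_adjacency[OF assms(1)])
  have pg: "pair_graph (ugraph G)" using assms(1) by (simp add: uq_gain_graph_def)
  have adj: "?A u v \<noteq> 0 \<longleftrightarrow> (u, v) \<in> garcs G" for u v by (rule adjacency_nonzero_iff[OF assms(1)])
  have fin: "finite ?V" by (rule pair_graph_finite(1)[OF pg])
  have linked: "linked ?V" using connected_iff_linked[OF pg adj] assms(2) by (simp add: gconnected_def)
  have pend: "pendants (ugraph G) = leaves ?V" by (rule pendants_eq_leaves[OF pg adj])
  have "leaves ?V \<noteq> {}" using assms(5) by (auto simp: gpendant_def pend)
  then obtain l where l: "l \<in> leaves ?V" by blast
  \<comment> \<open>A leaf comes with a neighbour. On a single vertex the formula for the bound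
    would fail: \<open>bnd\<close> is 1 there, while 2c + p - 1 is -1.\<close>
  have card2: "card S \<ge> 2" if "finite S" "v \<in> leaves S" for S v
  proof -
    have "card (nbrs S v) = 1" and vS: "v \<in> S" using that(2) by (auto simp: leaves_def)
    then obtain u where "nbrs S v = {u}" by (metis card_1_singletonE)
    then have "u \<in> nbrs S v" by simp
    then have "{u, v} \<subseteq> S" "u \<noteq> v" using vS diag[of v] by (auto simp: nbrs_def)
    then show ?thesis using card_mono[OF that(1), of "{u, v}"] by simp
  qed
  have bnd: "int (bnd ?V) = 2 * gcyclomatic G + int (gpendant G) - 1"
    unfolding gcyclomatic_def gpendant_def
    by (rule bnd_eq_cyclomatic[OF pg adj linked card2[OF fin l]])
  have "grank G + left_nullity ?A ?V ?V = n"
    using row_left_rank_plus_left_nullity[OF fin, of ?A ?V] assms(3) by (simp add: grank_def gorder_def)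
  then have lhs: "int (grank G) = int n - 2 * gcyclomatic G - int (gpendant G) + 1 \<longleftrightarrow>
      left_nullity ?A ?V ?V = bnd ?V"
    using bnd by linarith
  show ?thesis unfolding lhs
  proof
    assume "left_nullity ?A ?V ?V = bnd ?V"
    from extremal_decomposition[OF fin linked l this] obtain T L cy where
      tw: "tree_with_cycles ?V T L cy" and nul: "left_nullity ?A T T = bnd T"
      and bL: "bnd ?V = bnd T + card L" and lL: "card (leaves T) = card (leaves ?V) + card L"
      by blast
    note tw = tw[unfolded tree_with_cycles_def]
    have linT: "linked T" using tw by (elim conjE)
    have acyc: "acyclic_on T" using tw by (elim conjE)
    have LT: "L \<subseteq> leaves T" using tw by (elim conjE)
    have "\<forall>x\<in>L. closed_cycle (cy x) \<and> type1 (cy x) \<and> set (cy x) \<inter> T = {x}"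
      using tw by (elim conjE)
    then have cy: "\<And>x. x \<in> L \<Longrightarrow> closed_cycle (cy x)" "\<And>x. x \<in> L \<Longrightarrow> type1 (cy x)"
      "\<And>x. x \<in> L \<Longrightarrow> set (cy x) \<inter> T = {x}" by simp_all
    have dis: "\<forall>x\<in>L. \<forall>y\<in>L. x \<noteq> y \<longrightarrow> set (cy x) \<inter> set (cy y) = {}"
      using tw by (elim conjE)
    have un: "?V = T \<union> (\<Union>x\<in>L. set (cy x))" using tw by (elim conjE)
    have "\<forall>u\<in>?V. \<forall>v\<in>?V. ?A u v \<noteq> 0 \<longrightarrow> u \<in> T \<and> v \<in> T \<or> (\<exists>x\<in>L. (u, v) \<in> cycle_arcs (cy x))"
      using tw by (elim conjE)
    note arcs = this[rule_format]
    define E where "E = garcs G \<inter> T \<times> T"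
    define Tg where "Tg = \<lparr>ugraph = \<lparr>pverts = T, parcs = E\<rparr>, gain = gain G\<rparr>"
    define Cg where "Cg x = \<lparr>ugraph = \<lparr>pverts = set (cy x), parcs = cycle_arcs (cy x)\<rparr>, gain = gain G\<rparr>" for x
    have TV: "T \<subseteq> ?V" using un by blast
    have finT: "finite T" using TV fin by (rule finite_subset)
    have symE: "sym E" using parcs_symD[OF pg] by (auto simp: E_def sym_def)
    have uqT: "uq_gain_graph Tg"
      unfolding Tg_def using TV symE by (intro uq_gain_subgraph assms(1)) (auto simp: E_def)
    have pgT: "pair_graph (ugraph Tg)" using uqT by (simp add: uq_gain_graph_def)
    have adjT: "?A u v \<noteq> 0 \<longleftrightarrow> (u, v) \<in> parcs (ugraph Tg)"
      if "u \<in> pverts (ugraph Tg)" "v \<in> pverts (ugraph Tg)" for u v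
      using that adj by (simp add: Tg_def E_def)
    have pendT: "pendants (ugraph Tg) = leaves T"
      using pendants_eq_leaves[OF pgT adjT] by (simp add: Tg_def)
    have leavesT: "card (leaves T) = gpendant G + card L"
      using lL by (simp add: gpendant_def pend)
    then have "leaves T \<noteq> {}" using assms(5) by auto
    then have T2: "card T \<ge> 2" using card2[OF finT] by blast
    \<comment> \<open>The bound for a tree is p(T) - 1, so maximal nullity is exactly the rank
      condition on the tree.\<close>
    have bT: "bnd T + 1 = card (leaves T)"
      using acyclic_degree_sum[OF finT linT acyc] bnd_degree_sum[OF finT linT T2] by linarith
    have rankT: "grank Tg = row_left_rank ?A T T"
      unfolding grank_def by (simp add: Tg_def, rule row_left_rank_cong) (auto simp: adjacency_def E_def)
    have cycarcs: "cycle_arcs (cy x) \<subseteq> garcs G" if "x \<in> L" for x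
      using adj_cycle[OF cy(1)[OF that]] adj by (auto simp: cycle_arcs_def)
    have "gain_tree Tg"
      unfolding gain_tree_def using uqT acyclic_on_imp_tree_graph[OF pgT adjT] acyc linT by (simp add: Tg_def)
    \<comment> \<open>The bound is 2c + p - 1 for \<open>G\<close> and p + |L| - 1 for the tree, and
      the two differ by |L|; hence |L| = c.\<close>
    moreover have cL: "int (card L) = gcyclomatic G"
      using bnd bL bT leavesT by linarith
    moreover have "int (gpendant Tg) > gcyclomatic G"
      using cL leavesT assms(5) by (simp add: gpendant_def pendT)
    moreover have "int (grank Tg) = int (gorder Tg) - int (gpendant Tg) + 1"
      using row_left_rank_plus_left_nullity[OF finT, of ?A T] nul bT
      unfolding rankT gpendant_def pendT by (simp add: gorder_def Tg_def)
    moreover have "type1_cycle (Cg x)" if x: "x \<in> L" for x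
      unfolding type1_cycle_def
    proof (intro conjI exI)
      have ne: "cy x \<noteq> []" using cy(1)[OF x] by (rule closed_cycle_nonempty)
      show "uq_gain_graph (Cg x)"
        unfolding Cg_def using un x cycarcs[OF x] cyc_nth_in_set[OF ne]
        by (intro uq_gain_subgraph assms(1)) (auto simp: sym_def cycle_arcs_def)
      show "cycle_order (ugraph (Cg x)) (cy x)"
        using closed_cycle_cycle_order[OF cy(1)[OF x]] by (simp add: Cg_def)
      show "even (length (cy x))" using cy(2)[OF x] by (simp add: type1_def)
      have "gain G u v = ?A u v" if "(u, v) \<in> cycle_arcs (cy x)" for u v
        using cycarcs[OF x] that by (auto simp: adjacency_def)
      moreover have "(cy x ! i, cy x ! (Suc i mod length (cy x))) \<in> cycle_arcs (cy x)"
        if "i < length (cy x)" for i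
        using that by (auto simp: cycle_arcs_conv[OF ne])
      ultimately have "cycle_gain (Cg x) (cy x) = path_gain (cy x) (length (cy x))"
        unfolding cycle_gain_def path_gain_length[OF ne]
        by (intro arg_cong[of _ _ prod_list] map_cong) (auto simp: Cg_def)
      then show "cycle_gain (Cg x) (cy x) = (- 1) ^ (length (cy x) div 2)"
        using cy(2)[OF x] by (simp add: type1_def)
    qed
    moreover have "attached_cycles G Tg L Cg"
      unfolding attached_cycles_def
    proof (intro conjI)
      show "L \<subseteq> pendants (ugraph Tg)" using LT pendT by simp
      show "\<forall>x\<in>L. gverts (Cg x) \<inter> gverts Tg = {x}" using cy(3) by (simp add: Cg_def Tg_def)
      show "\<forall>x\<in>L. \<forall>y\<in>L. x \<noteq> y \<longrightarrow> gverts (Cg x) \<inter> gverts (Cg y) = {}"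
        using dis by (simp add: Cg_def)
      show "?V = gverts Tg \<union> (\<Union>x\<in>L. gverts (Cg x))" using un by (simp add: Cg_def Tg_def)
      show "garcs G = garcs Tg \<union> (\<Union>x\<in>L. garcs (Cg x))"
      proof
        show "garcs G \<subseteq> garcs Tg \<union> (\<Union>x\<in>L. garcs (Cg x))"
        proof
          fix e assume e: "e \<in> garcs G"
          obtain u v where uv: "e = (u, v)" by fastforce
          then show "e \<in> garcs Tg \<union> (\<Union>x\<in>L. garcs (Cg x))"
            using arcs[of u v] parcs_in_pverts[OF pg] e adj by (auto simp: Tg_def Cg_def E_def)
        qed
        show "garcs Tg \<union> (\<Union>x\<in>L. garcs (Cg x)) \<subseteq> garcs G"
          using cycarcs by (auto simp: Tg_def Cg_def E_def)
      qed
    qed (simp_all add: Tg_def Cg_def)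
    ultimately show "\<exists>T L C. gain_tree T \<and>
       int (gpendant T) > gcyclomatic G \<and>
       int (grank T) = int (gorder T) - int (gpendant T) + 1 \<and>
       int (card L) = gcyclomatic G \<and>
       (\<forall>x\<in>L. type1_cycle (C x)) \<and>
       attached_cycles G T L C" by blast
  next
    assume "\<exists>T L C. gain_tree T \<and>
       int (gpendant T) > gcyclomatic G \<and>
       int (grank T) = int (gorder T) - int (gpendant T) + 1 \<and>
       int (card L) = gcyclomatic G \<and>
       (\<forall>x\<in>L. type1_cycle (C x)) \<and>
       attached_cycles G T L C"
    then obtain T L and C :: "'a \<Rightarrow> 'a gain_graph" where T: "gain_tree T"
      and rT: "int (grank T) = int (gorder T) - int (gpendant T) + 1"
      and cL: "int (card L) = gcyclomatic G"
      and t1: "\<And>x. x \<in> L \<Longrightarrow> type1_cycle (C x)" and att: "attached_cycles G T L C"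
      by blast
    have LT: "L \<subseteq> pendants (ugraph T)"
      and CT: "\<And>x. x \<in> L \<Longrightarrow> gverts (C x) \<inter> gverts T = {x}"
      and CC: "\<And>x y. x \<in> L \<Longrightarrow> y \<in> L \<Longrightarrow> x \<noteq> y \<Longrightarrow> gverts (C x) \<inter> gverts (C y) = {}"
      and un: "?V = gverts T \<union> (\<Union>x\<in>L. gverts (C x))"
      and arcs: "garcs G = garcs T \<union> (\<Union>x\<in>L. garcs (C x))"
      and gT: "\<And>u v. (u, v) \<in> garcs T \<Longrightarrow> gain G u v = gain T u v"
      and gC: "\<And>x u v. x \<in> L \<Longrightarrow> (u, v) \<in> garcs (C x) \<Longrightarrow> gain G u v = gain (C x) u v"
      using att unfolding attached_cycles_def by auto
    have pgT: "pair_graph (ugraph T)" using T by (simp add: gain_tree_def uq_gain_graph_def)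
    have pgC: "pair_graph (ugraph (C x))" if "x \<in> L" for x
      using t1[OF that] by (simp add: type1_cycle_def uq_gain_graph_def)
    have finT: "finite (gverts T)" by (rule pair_graph_finite(1)[OF pgT])
    have LgT: "L \<subseteq> gverts T" using LT by (auto simp: pendants_def)
    have finL: "finite L" using LgT finT by (rule finite_subset)
    \<comment> \<open>The tree is induced in \<open>G\<close>: a cycle arc with both ends in the
      tree would be a loop at the attachment vertex.\<close>
    have Tarc: "(u, v) \<in> garcs T" if uv: "u \<in> gverts T" "v \<in> gverts T" "(u, v) \<in> garcs G" for u v
    proof (rule ccontr)
      assume "(u, v) \<notin> garcs T"
      then obtain x where x: "x \<in> L" "(u, v) \<in> garcs (C x)" using uv(3) arcs by auto
      then have "u \<in> gverts (C x) \<inter> gverts T" "v \<in> gverts (C x) \<inter> gverts T"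
        using uv parcs_in_pverts[OF pgC[OF x(1)]] by auto
      then have "u = v" using CT[OF x(1)] by simp
      then show False using x parcs_irrefl[OF pgC[OF x(1)]] by simp
    qed
    have "\<exists>us. closed_cycle us \<and> type1 us \<and> set us = gverts (C x) \<and> cycle_arcs us = garcs (C x)"
      if x: "x \<in> L" for x
    proof -
      obtain us where us: "cycle_order (ugraph (C x)) us" "even (length us)"
        "cycle_gain (C x) us = (- 1) ^ (length us div 2)"
        using t1[OF x] by (auto simp: type1_cycle_def)
      have nz: "?A u v \<noteq> 0" if "(u, v) \<in> garcs (C x)" for u v using adj arcs x that by auto
      note cc = cycle_order_closed_cycle[OF us(1) nz]
      have ne: "us \<noteq> []" using cc(1) by (rule closed_cycle_nonempty)
      have "gain (C x) u v = ?A u v" if "(u, v) \<in> cycle_arcs us" for u v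
        using that gC[OF x, of u v] cc(3) arcs x by (auto simp: adjacency_def)
      moreover have "(us ! i, us ! (Suc i mod length us)) \<in> cycle_arcs us" if "i < length us" for i
        using that by (auto simp: cycle_arcs_conv[OF ne])
      ultimately have "cycle_gain (C x) us = path_gain us (length us)"
        unfolding cycle_gain_def path_gain_length[OF ne]
        by (intro arg_cong[of _ _ prod_list] map_cong) auto
      then show ?thesis using cc us by (auto simp: type1_def)
    qed
    then obtain cy where cy: "\<And>x. x \<in> L \<Longrightarrow> closed_cycle (cy x)" "\<And>x. x \<in> L \<Longrightarrow> type1 (cy x)"
      "\<And>x. x \<in> L \<Longrightarrow> set (cy x) = gverts (C x)" "\<And>x. x \<in> L \<Longrightarrow> cycle_arcs (cy x) = garcs (C x)"
      by metis
    have unc: "gverts T \<union> (\<Union>x\<in>L. set (cy x)) = ?V" using un cy(3) by simp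
    have nulG: "left_nullity ?A ?V ?V = left_nullity ?A (gverts T) (gverts T) + card L"
    proof (rule left_nullity_attach[OF finT finL, of cy, unfolded unc])
      fix u v assume uv: "u \<in> ?V" "v \<in> ?V" "?A u v \<noteq> 0"
      show "u \<in> gverts T \<and> v \<in> gverts T \<or> (\<exists>x\<in>L. (u, v) \<in> cycle_arcs (cy x))"
        using uv(3) adj arcs parcs_in_pverts[OF pgT] cy(4) by auto
    qed (use cy CT CC in auto)
    have rankT: "grank T = row_left_rank ?A (gverts T) (gverts T)"
      unfolding grank_def
    proof (rule row_left_rank_cong)
      fix u v assume "u \<in> gverts T" "v \<in> gverts T"
      then show "adjacency T u v = ?A u v"
        using Tarc[of u v] gT[of u v] arcs by (auto simp: adjacency_def)
    qed
    have nulT: "int (left_nullity ?A (gverts T) (gverts T)) = int (gpendant T) - 1"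
      using row_left_rank_plus_left_nullity[OF finT, of ?A "gverts T"] rT
      unfolding rankT by (simp add: gorder_def)
    have out: "{u. (v, u) \<in> garcs G} = {u. (v, u) \<in> garcs T}" if v: "v \<in> gverts T - L" for v
    proof -
      have "(v, u) \<notin> garcs (C x)" if x: "x \<in> L" for u x
      proof
        assume "(v, u) \<in> garcs (C x)"
        then have "v \<in> gverts (C x) \<inter> gverts T" using parcs_in_pverts[OF pgC[OF x]] v by blast
        then show False using CT[OF x] v x by auto
      qed
      then show ?thesis using arcs by auto
    qed
    have notpend: "v \<notin> leaves ?V" if x: "x \<in> L" "v \<in> gverts (C x)" for x v
    proof -
      have "gverts (C x) \<subseteq> ?V" using x(1) unfolding un by blast
      then have "deg ?V v \<ge> 2"
        using cycle_deg_ge_2[OF fin cy(1)[OF x(1)], of v] x(2) cy(3)[OF x(1)] by simp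
      then show ?thesis by (simp add: leaves_def)
    qed
    have "pendants (ugraph G) = pendants (ugraph T) - L"
    proof (intro equalityI subsetI)
      fix v assume v: "v \<in> pendants (ugraph G)"
      then have vG: "v \<in> ?V" by (simp add: pendants_def)
      have "v \<in> gverts T - L" using v vG un notpend CT unfolding pend by blast
      then show "v \<in> pendants (ugraph T) - L"
        using v out[of v] by (simp add: pendants_def out_degree_eq_card)
    next
      fix v assume v: "v \<in> pendants (ugraph T) - L"
      then have "v \<in> gverts T - L" by (simp add: pendants_def)
      then show "v \<in> pendants (ugraph G)"
        using v out[of v] un by (simp add: pendants_def out_degree_eq_card)
    qed
    \<comment> \<open>Hence p(T) = p + c, and the nullity p(T) - 1 of the tree plus 1 for each cycle
      gives 2c + p - 1.\<close>
    then have "gpendant G + card L = gpendant T"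
      using LT finL finT card_mono[of "pendants (ugraph T)" L]
      by (simp add: gpendant_def card_Diff_subset pendants_def)
    then show "left_nullity ?A ?V ?V = bnd ?V"
      using nulG nulT bnd cL by linarith
  qed
qed

end
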